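(* Let $L$ be a sectionally complemented, modular, conditionally $\aleph_0$-meet-continuous lattice. Then there exists exactly one normal equivalence $\equiv$ on $L$, defined by the following rule: $a\equiv b$ if and only if there are $a_i$ and $b_i$ (for $i<2$) such that $a=a_0\oplus a_1$, $b=b_0\oplus b_1$, and $a_i\sim b_i$ (for all $i<2$).
   Context: A lattice is sectionally complemented if it has a least element $0$ and every interval $[0,a]$ is complemented. A lattice $K$ is $\aleph_0$-meet-continuous if for every $a\in K$ and every increasing sequence $\langle b_n\mid n\in\omega\rangle$ of elements of $K$, the supremum $\bigvee_nb_n$ exists and $a\wedge\bigvee_nb_n=\bigvee_n(a\wedge b_n)$. A lattice is conditionally $\aleph_0$-meet-continuous if each of its closed intervals is $\aleph_0$-meet-continuous. In a modular lattice with zero, $x\perp y$ means $x\wedge y=0$, and $z=x\oplus y$ means $x\wedge y=0$ and $x\vee y=z$. Elements $x,y$ of a lattice are perspective, $x\sim y$, if there is $t$ with $x\wedge t=y\wedge t$ and $x\vee t=y\vee t$. A normal equivalence on a modular lattice $L$ with zero is an equivalence relation $\equiv$ on $L$ such that: (E1) $\equiv$ is additive ($x\equiv x'$, $y\equiv y'$ and both $x\oplus y$ and $x'\oplus y'$ defined imply $x\oplus y\equiv x'\oplus y'$) and refining (if $y\equiv x_0\oplus x_1$, then there are $y_0\equiv x_0$ and $y_1\equiv x_1$ with $y=y_0\oplus y_1$); (E2) $x\sim y$ implies $x\equiv y$; (E3) $x\perp y$ and $x\equiv y$ imply $x\sim y$. *)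

theory Defs
  imports Main "HOL-Library.Lub_Glb"
begin

unbundle lattice_syntax

class modular_lattice = lattice +
  assumes modular: "x \<le> z \<Longrightarrow> sup x (inf y z) = inf (sup x y) z"

class sectionally_complemented_lattice = bounded_lattice_bot +
  assumes section_complement: "x \<le> a \<Longrightarrow> \<exists>y\<le>a. inf x y = bot \<and> sup x y = a"

(* Intended for sublattices K, which inherit meets from the ambient lattice.  Suprema of
   sequences, in contrast, are taken relative to K: in isLub K, the upper bounds range over K. *)
definition aleph0_meet_continuous_on :: "'a::lattice set \<Rightarrow> bool" where
  "aleph0_meet_continuous_on K \<longleftrightarrow>
     (\<forall>a\<in>K. \<forall>b::nat \<Rightarrow> 'a. range b \<subseteq> K \<and> incseq b \<longrightarrow>
        (\<exists>s. isLub K (range b) s \<and> isLub K (range (\<lambda>n. a \<sqinter> b n)) (a \<sqinter> s)))"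

definition conditionally_aleph0_meet_continuous :: "'a::lattice itself \<Rightarrow> bool" where
  "conditionally_aleph0_meet_continuous _ \<longleftrightarrow> (\<forall>c d::'a. aleph0_meet_continuous_on {c..d})"

definition perp :: "'a::bounded_lattice_bot \<Rightarrow> 'a \<Rightarrow> bool" where
  "perp x y \<longleftrightarrow> x \<sqinter> y = \<bottom>"

(* "z is the orthogonal sum of x and y": the sum is a partial operation, hence a relation. *)
definition is_oplus :: "'a::bounded_lattice_bot \<Rightarrow> 'a \<Rightarrow> 'a \<Rightarrow> bool" where
  "is_oplus z x y \<longleftrightarrow> perp x y \<and> z = x \<squnion> y"

definition perspective :: "'a::lattice \<Rightarrow> 'a \<Rightarrow> bool" where
  "perspective x y \<longleftrightarrow> (\<exists>t. x \<sqinter> t = y \<sqinter> t \<and> x \<squnion> t = y \<squnion> t)"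

definition additive :: "('a::bounded_lattice_bot \<Rightarrow> 'a \<Rightarrow> bool) \<Rightarrow> bool" where
  "additive R \<longleftrightarrow> (\<forall>x x' y y' z z'.
     R x x' \<and> R y y' \<and> is_oplus z x y \<and> is_oplus z' x' y' \<longrightarrow> R z z')"

definition refining :: "('a::bounded_lattice_bot \<Rightarrow> 'a \<Rightarrow> bool) \<Rightarrow> bool" where
  "refining R \<longleftrightarrow> (\<forall>y x x0 x1. is_oplus x x0 x1 \<and> R y x \<longrightarrow>
     (\<exists>y0 y1. R y0 x0 \<and> R y1 x1 \<and> is_oplus y y0 y1))"

definition normal_equivalence :: "('a::bounded_lattice_bot \<Rightarrow> 'a \<Rightarrow> bool) \<Rightarrow> bool" where
  "normal_equivalence R \<longleftrightarrow> equivp R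
     \<and> additive R \<and> refining R
     \<and> (\<forall>x y. perspective x y \<longrightarrow> R x y)
     \<and> (\<forall>x y. perp x y \<and> R x y \<longrightarrow> perspective x y)"

end

theory Submission
  imports Defs
begin

text \<open>
Below, "disjoint" means meeting in \<open>\<bottom>\<close>, and sums are joins of disjoint elements.

Existence. The candidate \<open>piecewise_projective\<close> relates two elements when they split into finitely
many summands that are projective in pairs. In every sectionally complemented modular lattice it is
an additive and refining equivalence that contains perspectivity, because any two decompositions of
one element have a common refinement up to perspectivity (\<open>common_refinement\<close>). What needs
continuity is that disjoint projective elements are perspective
(\<open>projective_disjoint_imp_perspective\<close>). Continuity enters in three ways. Perspectivities between
matching summands of disjoint sequences have a common axis, the join of the single axes
(\<open>perspective_seq_lub\<close>). Hence perspectivity satisfies a Cantor-Bernstein theorem for disjoint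
elements (\<open>perspective_cantor_bernstein\<close>). Finally, let \<open>\<theta>\<close> be an isomorphism from the segment
below \<open>x\<close> onto the segment below \<open>z\<close>. Then \<open>x\<close> is the sum of a part built from summands \<open>u\<close>
disjoint from \<open>\<theta> u\<close>, and of a part that lies below \<open>z\<close> already (\<open>displaced_part\<close>). Suppose that
\<open>z\<close> is perspective to some \<open>w\<close> disjoint from \<open>x \<squnion> z\<close>, and that \<open>u\<close> and \<open>\<theta> u\<close> are perspective
whenever they are disjoint. Then the first part can be carried to \<open>w\<close> through \<open>\<theta>\<close> and the second
one directly. Doing this for \<open>\<theta>\<close> and for its inverse and applying Cantor-Bernstein shows that \<open>x\<close>
is perspective to \<open>w\<close> (\<open>perspective_shift\<close>). This shift principle first yields transitivity
\<open>a \<sim> b \<sim> c\<close> for disjoint \<open>a\<close>, \<open>c\<close>, and then, by induction, the collapse of longer chains.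

Uniqueness. Let \<open>R\<close> be any normal equivalence and \<open>R a b\<close>. Write \<open>c = a \<sqinter> b\<close>, \<open>a = c \<oplus> x\<close> and
\<open>b = c \<oplus> y\<close>. There is no cancellation, but repeated refinement of \<open>c \<oplus> x \<equiv> c \<oplus> y\<close>
(\<open>exchangeable_step\<close>) matches more and more of \<open>x\<close> with \<open>y\<close>, and each time puts disjoint copies of
what remains of \<open>x\<close> and of \<open>y\<close> into \<open>c\<close>. In the limit \<open>x = d \<oplus> x'\<close>, \<open>y = d' \<oplus> y'\<close> with
\<open>d \<sim> d'\<close>, and \<open>c\<close> contains an infinite independent sequence of copies of \<open>x'\<close> and one of \<open>y'\<close>.
The joins \<open>P\<close>, \<open>Q\<close> of these sequences split into halves \<open>P = P0 \<oplus> P1\<close>, \<open>Q = Q0 \<oplus> Q1\<close> for which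
\<open>P0 \<sim> P1\<close>, \<open>P1 \<oplus> x' \<sim> P0\<close>, \<open>Q0 \<sim> Q1\<close> and \<open>Q1 \<oplus> y' \<sim> Q0\<close> (\<open>absorption\<close>). If
\<open>c = P \<oplus> Q \<oplus> r\<close>, then
\<open>r \<oplus> P0 \<oplus> Q1 \<oplus> d \<sim> r \<oplus> P1 \<oplus> Q0 \<oplus> d'\<close> and \<open>P1 \<oplus> Q0 \<oplus> x' \<sim> P0 \<oplus> Q1 \<oplus> y'\<close> are the two
perspective pieces. So every normal equivalence coincides with the two-piece relation.
\<close>

section \<open>Modular lattices with sectional complements\<close>

lemma modular_inf_sup:
  fixes x y z :: "'a::modular_lattice"
  assumes "x \<le> z"
  shows "(x \<squnion> y) \<sqinter> z = x \<squnion> (y \<sqinter> z)" "(y \<squnion> x) \<sqinter> z = x \<squnion> (y \<sqinter> z)"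
    "z \<sqinter> (x \<squnion> y) = x \<squnion> (y \<sqinter> z)" "z \<sqinter> (y \<squnion> x) = x \<squnion> (y \<sqinter> z)"
  using modular[OF assms, of y] by (simp_all add: ac_simps)

lemma disjoint_mono:
  fixes x y :: "'a::bounded_lattice_bot"
  assumes "x \<sqinter> y = \<bottom>" "x' \<le> x" "y' \<le> y"
  shows "x' \<sqinter> y' = \<bottom>"
  using inf_mono[OF assms(2,3)] assms(1) by (simp add: bot_unique)

text \<open>
The basic tool for moving a summand of an independent triple to the other side of a meet.
\<close>
lemma disjoint_rotate:
  fixes x y z :: "'a::{bounded_lattice_bot, modular_lattice}"
  assumes "x \<sqinter> y = \<bottom>" "(x \<squnion> y) \<sqinter> z = \<bottom>"
  shows "x \<sqinter> (y \<squnion> z) = \<bottom>"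
proof -
  have "x \<sqinter> (y \<squnion> z) \<le> (x \<squnion> y) \<sqinter> (y \<squnion> z)"
    by (simp add: le_infI1)
  also have "\<dots> = y"
    using modular_inf_sup(3)[of y "x \<squnion> y" z] assms(2) by (simp add: inf_commute)
  finally have "x \<sqinter> (y \<squnion> z) \<le> x \<sqinter> y" by simp
  then show ?thesis using assms(1) by (simp add: bot_unique)
qed

text \<open>
Although the lattice need not be distributive, meets can be computed componentwise along a fixed
direct decomposition \<open>e \<oplus> e'\<close>. Most independence claims below are instances.
\<close>
lemma inf_of_direct_sums:
  fixes p :: "'a::{bounded_lattice_bot, modular_lattice}"
  assumes "e \<sqinter> e' = \<bottom>" "p \<le> e" "q \<le> e" "p' \<le> e'" "q' \<le> e'"
  shows "(p \<squnion> p') \<sqinter> (q \<squnion> q') = (p \<sqinter> q) \<squnion> (p' \<sqinter> q')"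
proof (rule antisym)
  have 1: "q \<sqinter> (p \<squnion> e') \<le> q \<sqinter> p"
  proof -
    have "e \<sqinter> (p \<squnion> e') = p"
      using modular_inf_sup(3)[OF assms(2), of e'] assms(1) by (simp add: inf_commute)
    then show ?thesis using assms(3) by (metis inf.absorb1 inf_assoc order_refl)
  qed
  have 2: "q' \<sqinter> (p \<squnion> p') \<le> q' \<sqinter> p'"
  proof -
    have "e' \<sqinter> (p \<squnion> p') = p' \<squnion> (p \<sqinter> e')"
      using modular_inf_sup(4)[OF assms(4), of p] by simp
    also have "p \<sqinter> e' = \<bottom>" using disjoint_mono[OF assms(1,2) order_refl] .
    finally show ?thesis using assms(5) by (metis inf.absorb1 inf_assoc order_refl sup_bot_right)
  qed
  have "(p \<squnion> p') \<sqinter> (q \<squnion> q') \<le> (p \<squnion> e') \<sqinter> (q \<squnion> q')"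
    using assms(4) by (meson inf_mono order_refl sup_mono)
  also have "\<dots> = q' \<squnion> (q \<sqinter> (p \<squnion> e'))"
    using modular_inf_sup(4)[of q' "p \<squnion> e'" q] assms(5) by (simp add: le_supI2)
  also have "\<dots> \<le> q' \<squnion> (q \<sqinter> p)" using 1 by (meson order_refl sup_mono)
  finally have "(p \<squnion> p') \<sqinter> (q \<squnion> q') \<le> (p \<squnion> p') \<sqinter> (q' \<squnion> (q \<sqinter> p))" by simp
  also have "\<dots> = (q \<sqinter> p) \<squnion> (q' \<sqinter> (p \<squnion> p'))"
    using modular_inf_sup(4)[of "q \<sqinter> p" "p \<squnion> p'" q'] by (simp add: le_infI2 le_supI1)
  also have "\<dots> \<le> (q \<sqinter> p) \<squnion> (q' \<sqinter> p')" using 2 by (meson order_refl sup_mono)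
  finally show "(p \<squnion> p') \<sqinter> (q \<squnion> q') \<le> (p \<sqinter> q) \<squnion> (p' \<sqinter> q')"
    by (simp add: inf_commute)
  show "(p \<sqinter> q) \<squnion> (p' \<sqinter> q') \<le> (p \<squnion> p') \<sqinter> (q \<squnion> q')"
    by (simp add: le_infI1 le_infI2 le_supI1 le_supI2)
qed

lemma disjoint_sums:
  fixes p :: "'a::{bounded_lattice_bot, modular_lattice}"
  assumes "e \<sqinter> e' = \<bottom>" "p \<le> e" "q \<le> e" "p' \<le> e'" "q' \<le> e'"
    "p \<sqinter> q = \<bottom>" "p' \<sqinter> q' = \<bottom>"
  shows "(p \<squnion> p') \<sqinter> (q \<squnion> q') = \<bottom>"
  using inf_of_direct_sums[OF assms(1-5)] assms(6,7) by simp

lemma relative_complement: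
  fixes x y :: "'a::sectionally_complemented_lattice"
  obtains u where "u \<le> y" "x \<sqinter> u = \<bottom>" "x \<squnion> u = x \<squnion> y"
proof -
  obtain u where u: "u \<le> y" "(x \<sqinter> y) \<sqinter> u = \<bottom>" "(x \<sqinter> y) \<squnion> u = y"
    using section_complement[of "x \<sqinter> y" y] by auto
  have "x \<sqinter> u = \<bottom>" using u(1,2) by (metis inf.absorb2 inf_assoc)
  moreover have "x \<squnion> u = x \<squnion> y" using u(3) by (metis sup_inf_absorb sup_assoc)
  ultimately show ?thesis using that u(1) by blast
qed

section \<open>Perspectivity\<close>

lemma perspective_sym: "perspective x y \<Longrightarrow> perspective y x"
  by (auto simp: perspective_def eq_commute)

lemma perspective_refl: "perspective x x"
  by (auto simp: perspective_def)

lemma perspectiveI: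
  "x \<sqinter> t = \<bottom> \<Longrightarrow> y \<sqinter> t = \<bottom> \<Longrightarrow> x \<squnion> t = y \<squnion> t \<Longrightarrow> perspective x y"
  unfolding perspective_def by (intro exI[of _ t]) simp

text \<open>
A normalised witness of perspectivity: being disjoint from \<open>x\<close> and \<open>y\<close> and lying below their join,
axes of independent pairs can be added.
\<close>
definition axis :: "'a::bounded_lattice_bot \<Rightarrow> 'a \<Rightarrow> 'a \<Rightarrow> bool" where
  "axis t x y \<longleftrightarrow> x \<sqinter> t = \<bottom> \<and> y \<sqinter> t = \<bottom> \<and> x \<squnion> t = x \<squnion> y \<and> y \<squnion> t = x \<squnion> y"

lemma axis_le: "axis t x y \<Longrightarrow> t \<le> x \<squnion> y"
  unfolding axis_def by (metis sup_ge2)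

lemma axis_imp_perspective: "axis t x y \<Longrightarrow> perspective x y"
  unfolding axis_def by (intro perspectiveI[of x t y]) auto

text \<open>
From an arbitrary witness \<open>t\<close>, one first splits off \<open>x \<sqinter> t\<close> and then cuts down to \<open>x \<squnion> y\<close>; the
modular law ensures that both steps keep the joins with \<open>x\<close> and \<open>y\<close> equal.
\<close>
lemma perspective_axis:
  fixes x y :: "'a::{sectionally_complemented_lattice, modular_lattice}"
  assumes "perspective x y"
  obtains t where "axis t x y"
proof -
  obtain t where t: "x \<sqinter> t = y \<sqinter> t" "x \<squnion> t = y \<squnion> t"
    using assms by (auto simp: perspective_def)
  obtain s where s: "s \<le> t" "(x \<sqinter> t) \<sqinter> s = \<bottom>" "(x \<sqinter> t) \<squnion> s = t"
    using section_complement[of "x \<sqinter> t" t] by auto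
  define r where "r = s \<sqinter> (x \<squnion> y)"
  have xs: "x \<sqinter> s = \<bottom>" "y \<sqinter> s = \<bottom>"
    using s(1,2) t(1) by (metis inf.absorb2 inf_assoc)+
  have "x \<squnion> s = x \<squnion> t" using s(3) by (metis sup_inf_absorb sup_assoc)
  moreover have "y \<squnion> s = y \<squnion> t" using s(3) t(1) by (metis sup_inf_absorb sup_assoc)
  ultimately have j: "x \<squnion> s = y \<squnion> s" using t(2) by simp
  have "x \<squnion> r = (x \<squnion> s) \<sqinter> (x \<squnion> y)"
    unfolding r_def using modular[of x "x \<squnion> y" s] by simp
  moreover have "y \<squnion> r = (y \<squnion> s) \<sqinter> (x \<squnion> y)"
    unfolding r_def using modular[of y "x \<squnion> y" s] by simp
  ultimately have e: "x \<squnion> r = y \<squnion> r" using j by simp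
  have "x \<squnion> r = x \<squnion> y"
  proof (rule antisym)
    show "x \<squnion> r \<le> x \<squnion> y" unfolding r_def by simp
    show "x \<squnion> y \<le> x \<squnion> r" using e by (metis sup.boundedI sup_ge1)
  qed
  moreover have "x \<sqinter> r = \<bottom>" "y \<sqinter> r = \<bottom>"
    using xs unfolding r_def by (auto intro: disjoint_mono)
  ultimately show ?thesis using that e unfolding axis_def by metis
qed

lemma axis_sum:
  fixes x y :: "'a::{sectionally_complemented_lattice, modular_lattice}"
  assumes "axis t x y" "axis t' x' y'" "(x \<squnion> y) \<sqinter> (x' \<squnion> y') = \<bottom>"
  shows "axis (t \<squnion> t') (x \<squnion> x') (y \<squnion> y')"
proof -
  have "(x \<squnion> x') \<sqinter> (t \<squnion> t') = \<bottom>" "(y \<squnion> y') \<sqinter> (t \<squnion> t') = \<bottom>"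
    using assms axis_le[OF assms(1)] axis_le[OF assms(2)]
    by (auto intro!: disjoint_sums[OF assms(3)] simp: axis_def)
  moreover have "(x \<squnion> x') \<squnion> (t \<squnion> t') = (x \<squnion> t) \<squnion> (x' \<squnion> t')" by (simp add: ac_simps)
  moreover have "(y \<squnion> y') \<squnion> (t \<squnion> t') = (y \<squnion> t) \<squnion> (y' \<squnion> t')" by (simp add: ac_simps)
  moreover have "(x \<squnion> x') \<squnion> (y \<squnion> y') = (x \<squnion> y) \<squnion> (x' \<squnion> y')" by (simp add: ac_simps)
  ultimately show ?thesis using assms(1,2) unfolding axis_def by simp
qed

lemma perspective_sum:
  fixes x y :: "'a::{sectionally_complemented_lattice, modular_lattice}"
  assumes "perspective x y" "perspective x' y'" "(x \<squnion> y) \<sqinter> (x' \<squnion> y') = \<bottom>"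
  shows "perspective (x \<squnion> x') (y \<squnion> y')"
  using assms by (meson axis_imp_perspective axis_sum perspective_axis)

lemma perspective_sum_disjoint:
  fixes x y :: "'a::{sectionally_complemented_lattice, modular_lattice}"
  assumes "perspective x y" "perspective x' y'" "x \<sqinter> x' = \<bottom>" "y \<sqinter> y' = \<bottom>"
    "(x \<squnion> x') \<sqinter> (y \<squnion> y') = \<bottom>"
  shows "perspective (x \<squnion> x') (y \<squnion> y')"
  using assms(1,2)
proof (rule perspective_sum)
  show "(x \<squnion> y) \<sqinter> (x' \<squnion> y') = \<bottom>"
    using disjoint_sums[OF assms(5), of x x' y y'] assms(3,4) by simp
qed

text \<open>
Perspectivity is not transitive in general. It composes here because the hypothesis implies
\<open>(x \<squnion> y) \<sqinter> (y \<squnion> z) = y\<close>: the two axes \<open>s\<close>, \<open>t\<close> do not interfere with each other, and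
\<open>(s \<squnion> t) \<sqinter> (x \<squnion> z)\<close> is an axis for \<open>x\<close> and \<open>z\<close>.
\<close>
lemma perspective_trans_independent:
  fixes x y z :: "'a::{sectionally_complemented_lattice, modular_lattice}"
  assumes "perspective x y" "perspective y z" "(x \<squnion> y) \<sqinter> z = \<bottom>"
  shows "perspective x z"
proof -
  obtain s where s: "axis s x y" using perspective_axis[OF assms(1)] .
  obtain t where t: "axis t y z" using perspective_axis[OF assms(2)] .
  have key: "(x \<squnion> y) \<sqinter> (y \<squnion> z) = y"
    using modular_inf_sup(3)[of y "x \<squnion> y" z] assms(3) by (simp add: inf_commute)
  have st: "s \<sqinter> (y \<squnion> z) = \<bottom>" "t \<sqinter> (x \<squnion> y) = \<bottom>"
  proof -
    have "s \<sqinter> (y \<squnion> z) \<le> s \<sqinter> y"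
      using key axis_le[OF s] by (metis inf.absorb1 inf_assoc order_refl)
    then show "s \<sqinter> (y \<squnion> z) = \<bottom>"
      using s unfolding axis_def by (metis bot_unique inf_commute)
    have "t \<sqinter> (x \<squnion> y) \<le> t \<sqinter> y"
      using key axis_le[OF t] by (metis inf.absorb1 inf_assoc inf_commute order_refl)
    then show "t \<sqinter> (x \<squnion> y) = \<bottom>"
      using t unfolding axis_def by (metis bot_unique inf_commute)
  qed
  define u where "u = (s \<squnion> t) \<sqinter> (x \<squnion> z)"
  have "x \<sqinter> (s \<squnion> t) = \<bottom>"
  proof -
    have "(s \<squnion> t) \<sqinter> (x \<squnion> y) = s"
      using modular_inf_sup(1)[OF axis_le[OF s], of t] st(2) by simp
    then have "x \<sqinter> (s \<squnion> t) \<le> x \<sqinter> s" by (metis inf_mono inf_sup_absorb inf_assoc inf_commute order_refl)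
    then show ?thesis using s unfolding axis_def by (simp add: bot_unique)
  qed
  moreover have "z \<sqinter> (s \<squnion> t) = \<bottom>"
  proof -
    have "(s \<squnion> t) \<sqinter> (y \<squnion> z) = t"
      using modular_inf_sup(2)[OF axis_le[OF t], of s] st(1) by simp
    then have "z \<sqinter> (s \<squnion> t) \<le> z \<sqinter> t"
      by (metis inf_mono inf_sup_absorb inf_assoc inf_commute order_refl sup_commute)
    then show ?thesis using t unfolding axis_def by (simp add: bot_unique)
  qed
  ultimately have "x \<sqinter> u = \<bottom>" "z \<sqinter> u = \<bottom>" unfolding u_def by (auto intro: disjoint_mono)
  moreover have "x \<squnion> u = z \<squnion> u"
  proof -
    have "x \<squnion> (s \<squnion> t) = x \<squnion> y \<squnion> z" "z \<squnion> (s \<squnion> t) = x \<squnion> y \<squnion> z"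
      using s t unfolding axis_def by (metis sup_assoc sup_commute)+
    moreover have "x \<squnion> u = (x \<squnion> (s \<squnion> t)) \<sqinter> (x \<squnion> z)" "z \<squnion> u = (z \<squnion> (s \<squnion> t)) \<sqinter> (x \<squnion> z)"
      unfolding u_def by (rule modular; simp)+
    ultimately show ?thesis by simp
  qed
  ultimately show ?thesis by (rule perspectiveI)
qed

lemma perspective_trans_independent':
  fixes x y z :: "'a::{sectionally_complemented_lattice, modular_lattice}"
  assumes "perspective x y" "perspective y z" "x \<sqinter> (y \<squnion> z) = \<bottom>"
  shows "perspective x z"
  using perspective_trans_independent[of z y x] assms
  by (simp add: perspective_sym inf_commute sup_commute)

lemma complements_perspective:
  fixes x y z :: "'a::{sectionally_complemented_lattice, modular_lattice}"
  assumes "p \<sqinter> x = \<bottom>" "p \<sqinter> y = \<bottom>" "p \<squnion> x = p \<squnion> y"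
  shows "perspective x y"
  using assms by (intro perspectiveI[of x p y]) (simp_all add: inf_commute sup_commute)

text \<open>
With \<open>w\<close> a complement of \<open>p \<squnion> s\<close> in the whole, both \<open>q\<close> and \<open>s' \<oplus> w\<close> are complements of \<open>p\<close>, and
both \<open>t\<close> and \<open>p' \<oplus> w\<close> are complements of \<open>s\<close>. So the four common pieces are \<open>p \<sqinter> s\<close>, \<open>p'\<close>, \<open>s'\<close>
and \<open>w\<close>.
\<close>
lemma common_refinement:
  fixes p q s t :: "'a::{sectionally_complemented_lattice, modular_lattice}"
  assumes pq: "p \<sqinter> q = \<bottom>" and st: "s \<sqinter> t = \<bottom>" and eq: "p \<squnion> q = s \<squnion> t"
  obtains p' s' w where
    "is_oplus p (p \<sqinter> s) p'" "is_oplus s (p \<sqinter> s) s'"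
    "perp s' w" "perp p' w" "perspective q (s' \<squnion> w)" "perspective t (p' \<squnion> w)"
proof -
  obtain p' where p': "p' \<le> p" "(p \<sqinter> s) \<sqinter> p' = \<bottom>" "(p \<sqinter> s) \<squnion> p' = p"
    using section_complement[of "p \<sqinter> s" p] by auto
  obtain s' where s': "s' \<le> s" "(p \<sqinter> s) \<sqinter> s' = \<bottom>" "(p \<sqinter> s) \<squnion> s' = s"
    using section_complement[of "p \<sqinter> s" s] by auto
  have "p \<squnion> s \<le> p \<squnion> q" by (metis eq le_supI sup_ge1)
  then obtain w where w: "(p \<squnion> s) \<sqinter> w = \<bottom>" "(p \<squnion> s) \<squnion> w = p \<squnion> q"
    using section_complement by blast
  have "p \<sqinter> s' = \<bottom>" using s'(1,2) by (metis inf.absorb2 inf_assoc)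
  have "s \<sqinter> p' = \<bottom>" using p'(1,2) by (metis inf.absorb2 inf_assoc inf_commute)
  have ps': "p \<squnion> s' = p \<squnion> s" using s'(3) by (metis sup_inf_absorb sup_assoc)
  have sp': "s \<squnion> p' = p \<squnion> s" using p'(3) by (metis sup_inf_absorb sup_assoc inf_commute sup_commute)
  have "perspective q (s' \<squnion> w)"
  proof (rule complements_perspective[OF pq])
    show "p \<sqinter> (s' \<squnion> w) = \<bottom>" using \<open>p \<sqinter> s' = \<bottom>\<close> w(1) ps' by (auto intro: disjoint_rotate)
    show "p \<squnion> q = p \<squnion> (s' \<squnion> w)" using w(2) ps' by (simp add: sup_assoc[symmetric])
  qed
  moreover have "perspective t (p' \<squnion> w)"
  proof (rule complements_perspective[OF st])
    show "s \<sqinter> (p' \<squnion> w) = \<bottom>" using \<open>s \<sqinter> p' = \<bottom>\<close> w(1) sp' by (auto intro: disjoint_rotate)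
    show "s \<squnion> t = s \<squnion> (p' \<squnion> w)" using w(2) sp' eq by (simp add: sup_assoc[symmetric])
  qed
  moreover have "perp s' w" "perp p' w"
    unfolding perp_def by (rule disjoint_mono[OF w(1)]; use s'(1) p'(1) in \<open>simp add: le_supI1 le_supI2\<close>)+
  ultimately show ?thesis using that p' s' unfolding is_oplus_def perp_def by metis
qed

section \<open>Isomorphisms between initial segments\<close>

text \<open>
The inverse is an explicit argument, so that composition, restriction and inversion of
isomorphisms stay purely equational.
\<close>
definition segment_iso ::
  "('a::order \<Rightarrow> 'a) \<Rightarrow> ('a \<Rightarrow> 'a) \<Rightarrow> 'a \<Rightarrow> 'a \<Rightarrow> bool" where
  "segment_iso f g x y \<longleftrightarrow>
     (\<forall>u\<le>x. f u \<le> y \<and> g (f u) = u) \<and> (\<forall>v\<le>y. g v \<le> x \<and> f (g v) = v) \<and>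
     (\<forall>u v. u \<le> v \<longrightarrow> v \<le> x \<longrightarrow> f u \<le> f v) \<and> (\<forall>u v. u \<le> v \<longrightarrow> v \<le> y \<longrightarrow> g u \<le> g v)"

lemma segment_iso_sym: "segment_iso f g x y \<Longrightarrow> segment_iso g f y x"
  by (auto simp: segment_iso_def)

lemma segment_iso_le: "segment_iso f g x y \<Longrightarrow> u \<le> x \<Longrightarrow> f u \<le> y"
  by (auto simp: segment_iso_def)

lemma segment_iso_inverse: "segment_iso f g x y \<Longrightarrow> u \<le> x \<Longrightarrow> g (f u) = u"
  by (auto simp: segment_iso_def)

lemma segment_iso_mono: "segment_iso f g x y \<Longrightarrow> u \<le> v \<Longrightarrow> v \<le> x \<Longrightarrow> f u \<le> f v"
  by (auto simp: segment_iso_def)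

lemma segment_iso_refl: "segment_iso (\<lambda>u. u) (\<lambda>u. u) x x"
  by (auto simp: segment_iso_def)

lemma segment_iso_trans:
  "segment_iso f g x y \<Longrightarrow> segment_iso f' g' y z \<Longrightarrow>
     segment_iso (\<lambda>u. f' (f u)) (\<lambda>u. g (g' u)) x z"
  unfolding segment_iso_def by auto

lemma segment_iso_top: "segment_iso f g x y \<Longrightarrow> f x = y"
  unfolding segment_iso_def by (metis order_antisym order_refl)

lemma segment_iso_restrict:
  assumes "segment_iso f g x y" "u \<le> x"
  shows "segment_iso f g u (f u)"
proof -
  have "f u \<le> y" using assms by (rule segment_iso_le)
  then show ?thesis using assms unfolding segment_iso_def
    by (smt (verit) order_trans)
qed

lemma segment_iso_bot:
  fixes x :: "'a::bounded_lattice_bot"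
  assumes "segment_iso f g x y"
  shows "f \<bottom> = \<bottom>"
proof -
  have "g \<bottom> \<le> x" using assms by (simp add: segment_iso_def)
  then have "f \<bottom> \<le> f (g \<bottom>)" using segment_iso_mono[OF assms] by simp
  also have "f (g \<bottom>) = \<bottom>" using assms by (simp add: segment_iso_def)
  finally show ?thesis by (simp add: bot_unique)
qed

lemma segment_iso_sup:
  fixes x :: "'a::lattice"
  assumes "segment_iso f g x y" "u \<le> x" "v \<le> x"
  shows "f (u \<squnion> v) = f u \<squnion> f v"
proof (rule antisym)
  let ?w = "f u \<squnion> f v"
  have w: "?w \<le> y" using segment_iso_le[OF assms(1)] assms(2,3) by simp
  note i = segment_iso_sym[OF assms(1)]
  have "u \<le> g ?w" "v \<le> g ?w"
    using segment_iso_mono[OF i _ w] segment_iso_inverse[OF assms(1)] assms(2,3)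
    by (metis sup_ge1, metis sup_ge2)
  then have "f (u \<squnion> v) \<le> f (g ?w)"
    using segment_iso_mono[OF assms(1)] segment_iso_le[OF i w] by simp
  then show "f (u \<squnion> v) \<le> ?w" using segment_iso_inverse[OF i w] by simp
  show "?w \<le> f (u \<squnion> v)" using segment_iso_mono[OF assms(1)] assms(2,3) by simp
qed

lemma segment_iso_disjoint:
  fixes x :: "'a::bounded_lattice_bot"
  assumes "segment_iso f g x y" "u \<le> x" "v \<le> x" "u \<sqinter> v = \<bottom>"
  shows "f u \<sqinter> f v = \<bottom>"
proof -
  let ?w = "f u \<sqinter> f v"
  note i = segment_iso_sym[OF assms(1)]
  have w: "?w \<le> y" using segment_iso_le[OF assms(1) assms(2)] by (simp add: le_infI1)
  have "g ?w \<le> u" "g ?w \<le> v"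
    using segment_iso_mono[OF i] segment_iso_inverse[OF assms(1)] segment_iso_le[OF assms(1)] assms(2,3)
    by (metis inf_le1, metis inf_le2)
  then have "g ?w = \<bottom>" using assms(4) by (metis bot_unique le_infI)
  then show ?thesis using segment_iso_inverse[OF i w] segment_iso_bot[OF assms(1)] by simp
qed

lemma perspective_segment_iso:
  fixes x y :: "'a::{sectionally_complemented_lattice, modular_lattice}"
  assumes "x \<sqinter> t = \<bottom>" "y \<sqinter> t = \<bottom>" "x \<squnion> t = y \<squnion> t"
  shows "segment_iso (\<lambda>u. (u \<squnion> t) \<sqinter> y) (\<lambda>v. (v \<squnion> t) \<sqinter> x) x y"
    "u \<le> x \<Longrightarrow> ((u \<squnion> t) \<sqinter> y) \<squnion> t = u \<squnion> t"
    "u \<le> x \<Longrightarrow> perspective u ((u \<squnion> t) \<sqinter> y)"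
proof -
  have j: "((u \<squnion> t) \<sqinter> y') \<squnion> t = u \<squnion> t" if "u \<le> x'" "x' \<squnion> t = y' \<squnion> t" for u x' y' :: 'a
  proof -
    have "t \<squnion> (y' \<sqinter> (u \<squnion> t)) = (t \<squnion> y') \<sqinter> (u \<squnion> t)" by (rule modular) simp
    also have "\<dots> = u \<squnion> t" using that by (metis inf.absorb2 sup.mono order_refl sup_commute)
    finally show ?thesis by (simp add: ac_simps)
  qed
  have k: "(((u \<squnion> t) \<sqinter> y') \<squnion> t) \<sqinter> x' = u"
    if "u \<le> x'" "x' \<squnion> t = y' \<squnion> t" "x' \<sqinter> t = \<bottom>" for u x' y' :: 'a
    using j[OF that(1,2)] modular_inf_sup(1)[OF that(1), of t] that(3) by (simp add: inf_commute)
  show "segment_iso (\<lambda>u. (u \<squnion> t) \<sqinter> y) (\<lambda>v. (v \<squnion> t) \<sqinter> x) x y"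
    unfolding segment_iso_def using k[of _ x y] k[of _ y x] assms
    by (auto intro: inf_mono sup_mono le_infI1 le_supI1 order_trans[OF _ sup_ge1])
  show *: "((u \<squnion> t) \<sqinter> y) \<squnion> t = u \<squnion> t" if "u \<le> x"
    using j[OF that] assms by simp
  show "perspective u ((u \<squnion> t) \<sqinter> y)" if "u \<le> x"
    using *[OF that] assms disjoint_mono[OF assms(1) that order_refl] disjoint_mono[OF assms(2), of "(u \<squnion> t) \<sqinter> y" t]
    by (intro perspectiveI[of _ t]) auto
qed

lemma perspectivity:
  fixes x y :: "'a::{sectionally_complemented_lattice, modular_lattice}"
  assumes "perspective x y"
  obtains f g where "segment_iso f g x y" "\<And>u. u \<le> x \<Longrightarrow> perspective u (f u)"
proof -
  obtain t where "axis t x y" using perspective_axis[OF assms] .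
  then have "x \<sqinter> t = \<bottom>" "y \<sqinter> t = \<bottom>" "x \<squnion> t = y \<squnion> t" by (auto simp: axis_def)
  from perspective_segment_iso(1,3)[OF this] that show ?thesis by blast
qed

text \<open>
A chain of perspectivities transports all of the segment below \<open>x\<close>, each element along a chain of the
same length.
\<close>
lemma projectivity:
  fixes x y :: "'a::{sectionally_complemented_lattice, modular_lattice}"
  assumes "(perspective ^^ n) x y"
  shows "\<exists>f g. segment_iso f g x y \<and> (\<forall>u\<le>x. (perspective ^^ n) u (f u))"
  using assms
proof (induction n arbitrary: y)
  case 0
  then show ?case using segment_iso_refl by fastforce
next
  case (Suc n)
  then obtain w where w: "(perspective ^^ n) x w" "perspective w y" by auto
  obtain f g where f: "segment_iso f g x w" "\<forall>u\<le>x. (perspective ^^ n) u (f u)"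
    using Suc.IH[OF w(1)] by blast
  obtain f' g' where f': "segment_iso f' g' w y" "\<And>u. u \<le> w \<Longrightarrow> perspective u (f' u)"
    using perspectivity[OF w(2)] by blast
  have "\<forall>u\<le>x. (perspective ^^ Suc n) u (f' (f u))"
    using f f' segment_iso_le[OF f(1)] by auto
  then show ?case using segment_iso_trans[OF f(1) f'(1)] by blast
qed

lemma projective_sym: "(perspective ^^ n) x y \<Longrightarrow> (perspective ^^ n) y x"
proof (induction n arbitrary: y)
  case (Suc n)
  then obtain w where "(perspective ^^ n) x w" "perspective w y" by auto
  then show ?case using Suc.IH perspective_sym by (metis relpowp_Suc_I2)
qed auto

section \<open>Perspectivity and joins of sequences\<close>
definition seq_lub :: "(nat \<Rightarrow> 'a::order) \<Rightarrow> 'a \<Rightarrow> bool" where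
  "seq_lub U s \<longleftrightarrow> (\<forall>n. U n \<le> s) \<and> (\<forall>b. (\<forall>n. U n \<le> b) \<longrightarrow> s \<le> b)"

lemma seq_lub_upper: "seq_lub U s \<Longrightarrow> U n \<le> s"
  by (simp add: seq_lub_def)

lemma seq_lub_least: "seq_lub U s \<Longrightarrow> (\<And>n. U n \<le> b) \<Longrightarrow> s \<le> b"
  by (simp add: seq_lub_def)

lemma segment_iso_seq_lub:
  fixes x :: "'a::lattice"
  assumes iso: "segment_iso f g x y" and s: "seq_lub U s" "s \<le> x"
  shows "seq_lub (\<lambda>n. f (U n)) (f s)"
  unfolding seq_lub_def
proof (intro conjI allI impI)
  fix n show "f (U n) \<le> f s"
    using segment_iso_mono[OF iso seq_lub_upper[OF s(1)] s(2)] .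
next
  fix b assume b: "\<forall>n. f (U n) \<le> b"
  note iso' = segment_iso_sym[OF iso]
  have U: "U n \<le> x" for n using seq_lub_upper[OF s(1)] s(2) by (rule order_trans)
  have "U n \<le> g (b \<sqinter> y)" for n
  proof -
    have "f (U n) \<le> b \<sqinter> y" using b segment_iso_le[OF iso U] by simp
    then have "g (f (U n)) \<le> g (b \<sqinter> y)" using segment_iso_mono[OF iso'] by simp
    then show ?thesis using segment_iso_inverse[OF iso U] by simp
  qed
  then have "s \<le> g (b \<sqinter> y)" using seq_lub_least[OF s(1)] by blast
  then have "f s \<le> f (g (b \<sqinter> y))"
    using segment_iso_mono[OF iso] segment_iso_le[OF iso'] by simp
  also have "\<dots> = b \<sqinter> y" using segment_iso_inverse[OF iso'] by simp
  finally show "f s \<le> b" by simp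
qed

context
  assumes cont: "conditionally_aleph0_meet_continuous
    TYPE('a::{sectionally_complemented_lattice, modular_lattice})"
begin

text \<open>
A least upper bound relative to the segment below \<open>d\<close> is one in the whole lattice: any upper bound
may be cut down to its meet with \<open>d\<close>.
\<close>
lemma meet_continuous_segment:
  fixes U :: "nat \<Rightarrow> 'a"
  assumes inc: "\<And>n. U n \<le> U (Suc n)" and le: "\<And>n. U n \<le> d" and a: "a \<le> d"
  shows "\<exists>s\<le>d. seq_lub U s \<and> seq_lub (\<lambda>n. a \<sqinter> U n) (a \<sqinter> s)"
proof -
  have "incseq U" using inc by (rule incseq_SucI)
  moreover have "aleph0_meet_continuous_on {\<bottom>..d}"
    using cont unfolding conditionally_aleph0_meet_continuous_def by blast
  ultimately obtain s where s: "isLub {\<bottom>..d} (range U) s"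
    "isLub {\<bottom>..d} (range (\<lambda>n. a \<sqinter> U n)) (a \<sqinter> s)"
    unfolding aleph0_meet_continuous_on_def using le a
    by (metis atLeastAtMost_iff bot_least image_subsetI)
  have *: "seq_lub W r" if W: "isLub {\<bottom>..d} (range W) r" "\<And>n. W n \<le> d" for W :: "nat \<Rightarrow> 'a" and r
  proof -
    have r: "W n \<le> r" "r \<le> d" for n
      using W(1) by (auto simp: isLub_def leastP_def isUb_def setle_def)
    have "r \<le> b" if b: "\<forall>n. W n \<le> b" for b
    proof -
      have "isUb {\<bottom>..d} (range W) (b \<sqinter> d)"
        using b W(2) by (auto simp: isUb_def setle_def)
      then have "r \<le> b \<sqinter> d"
        using W(1) by (auto simp: isLub_def leastP_def setge_def)
      then show ?thesis by simp
    qed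
    then show ?thesis using r by (auto simp: seq_lub_def)
  qed
  have "s \<le> d" using s(1) by (auto simp: isLub_def leastP_def isUb_def)
  moreover have "seq_lub U s" using *[OF s(1)] le by blast
  moreover have "seq_lub (\<lambda>n. a \<sqinter> U n) (a \<sqinter> s)" using *[OF s(2)] a by (meson le_infI1)
  ultimately show ?thesis by blast
qed

lemma seq_lub_exists:
  fixes U :: "nat \<Rightarrow> 'a"
  assumes "\<And>n. U n \<le> U (Suc n)" "\<And>n. U n \<le> d"
  obtains s where "s \<le> d" "seq_lub U s"
  using meet_continuous_segment[of U d d, OF assms order_refl] by blast

lemma seq_lub_inf:
  fixes U :: "nat \<Rightarrow> 'a"
  assumes inc: "\<And>n. U n \<le> U (Suc n)" and s: "seq_lub U s"
  shows "seq_lub (\<lambda>n. a \<sqinter> U n) (a \<sqinter> s)"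
proof -
  obtain s' where s': "seq_lub U s'" "seq_lub (\<lambda>n. a \<sqinter> U n) (a \<sqinter> s')"
    using meet_continuous_segment[of U "a \<squnion> s" a] inc seq_lub_upper[OF s] by (auto intro: le_supI2)
  have "s' = s" using s s'(1) by (meson order_antisym seq_lub_least seq_lub_upper)
  then show ?thesis using s'(2) by simp
qed

text \<open>
Meet-continuity is used once for each of the two sequences.
\<close>
lemma disjoint_seq_lub:
  fixes U V :: "nat \<Rightarrow> 'a"
  assumes "\<And>n. U n \<le> U (Suc n)" "\<And>n. V n \<le> V (Suc n)" "seq_lub U s" "seq_lub V t"
    and disj: "\<And>n. U n \<sqinter> V n = \<bottom>"
  shows "s \<sqinter> t = \<bottom>"
proof -
  have mono: "mono U" "mono V" using assms(1,2) by (auto intro: incseq_SucI)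
  have "s \<sqinter> V n \<le> \<bottom>" for n
  proof -
    have "V n \<sqinter> U m \<le> \<bottom>" for m
    proof -
      have "V n \<sqinter> U m \<le> V (max m n) \<sqinter> U (max m n)"
        using monoD[OF mono(2), of n "max m n"] monoD[OF mono(1), of m "max m n"]
        by (intro inf_mono) auto
      then show ?thesis using disj[of "max m n"] by (simp add: inf_commute)
    qed
    then have "V n \<sqinter> s \<le> \<bottom>" using seq_lub_inf[of U, OF assms(1,3)] seq_lub_least by blast
    then show ?thesis by (simp add: inf_commute)
  qed
  then have "s \<sqinter> t \<le> \<bottom>" using seq_lub_inf[of V, OF assms(2,4)] seq_lub_least by blast
  then show ?thesis by (simp add: bot_unique)
qed

text \<open>
Countable additivity of perspectivity. The axes of the increments can be chosen so that their partial
joins are axes of \<open>U n\<close> and \<open>V n\<close>; by meet-continuity the join \<open>r\<close> of all of them is still disjoint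
from \<open>s\<close> and from \<open>t\<close>.
\<close>
lemma perspective_seq_lub:
  fixes U V :: "nat \<Rightarrow> 'a"
  assumes start: "perspective (U 0) (V 0)"
    and incr: "\<And>n. \<exists>u v. perspective u v \<and> U n \<sqinter> u = \<bottom> \<and> V n \<sqinter> v = \<bottom> \<and>
                  U (Suc n) = U n \<squnion> u \<and> V (Suc n) = V n \<squnion> v"
    and s: "seq_lub U s" and t: "seq_lub V t" and st: "s \<sqinter> t = \<bottom>"
  shows "perspective s t"
proof -
  have inc: "U n \<le> U (Suc n)" "V n \<le> V (Suc n)" for n
    using incr[of n] by (metis sup_ge1)+
  note le = seq_lub_upper[OF s] seq_lub_upper[OF t]
  have "\<exists>T. axis T (U 0) (V 0)" using perspective_axis[OF start] by blast
  moreover have "\<exists>T'. axis T' (U (Suc n)) (V (Suc n)) \<and> T \<le> T'" if T: "axis T (U n) (V n)" for n T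
  proof -
    obtain u v where uv: "perspective u v" "U n \<sqinter> u = \<bottom>" "V n \<sqinter> v = \<bottom>"
      "U (Suc n) = U n \<squnion> u" "V (Suc n) = V n \<squnion> v" using incr by blast
    obtain r where r: "axis r u v" using perspective_axis[OF uv(1)] .
    have "u \<le> s" "v \<le> t" using uv(4,5) le by (metis le_sup_iff)+
    then have "(U n \<squnion> V n) \<sqinter> (u \<squnion> v) = \<bottom>"
      using disjoint_sums[OF st] le uv(2,3) by simp
    then have "axis (T \<squnion> r) (U (Suc n)) (V (Suc n))" using axis_sum[OF T r] uv by simp
    then show ?thesis by (meson sup_ge1)
  qed
  ultimately obtain T where T: "\<And>n. axis (T n) (U n) (V n)" "\<And>n. T n \<le> T (Suc n)"
    using dependent_nat_choice[of "\<lambda>n T. axis T (U n) (V n)" "\<lambda>n T T'. T \<le> T'"] by metis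
  have "T n \<le> s \<squnion> t" for n
    using axis_le[OF T(1)] le by (meson order_trans sup_mono)
  then obtain r where r: "seq_lub T r" using seq_lub_exists[of T, OF T(2)] by blast
  have "s \<sqinter> r = \<bottom>" "t \<sqinter> r = \<bottom>"
    using T(1) by (auto intro!: disjoint_seq_lub[of U T, OF inc(1) T(2) s r]
        disjoint_seq_lub[of V T, OF inc(2) T(2) t r]
        simp: axis_def)
  moreover have "s \<squnion> r = t \<squnion> r"
  proof (rule antisym)
    have "U n \<le> t \<squnion> r" for n
    proof -
      have "U n \<le> V n \<squnion> T n" using T(1)[of n] unfolding axis_def by (metis sup_ge1)
      also have "\<dots> \<le> t \<squnion> r" using le seq_lub_upper[OF r] by (meson sup_mono)
      finally show ?thesis .
    qed
    then show "s \<squnion> r \<le> t \<squnion> r" using seq_lub_least[OF s] by simp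
    have "V n \<le> s \<squnion> r" for n
    proof -
      have "V n \<le> U n \<squnion> T n" using T(1)[of n] unfolding axis_def by (metis sup_ge2)
      also have "\<dots> \<le> s \<squnion> r" using le seq_lub_upper[OF r] by (meson sup_mono)
      finally show ?thesis .
    qed
    then show "t \<squnion> r \<le> s \<squnion> r" using seq_lub_least[OF t] by simp
  qed
  ultimately show ?thesis by (rule perspectiveI)
qed

section \<open>A Cantor-Bernstein theorem and the shift principle\<close>
text \<open>
As for sets: let \<open>f\<close> and \<open>g\<close> be the isomorphisms below \<open>x\<close> and \<open>w\<close> and \<open>a0\<close> a complement of
\<open>g w\<close> in \<open>x\<close>. The least \<open>B\<close> with \<open>B = a0 \<squnion> g (f B)\<close> is moved by \<open>f\<close>, and a complement of it is reached
by \<open>g\<close>. Both maps move every element to a perspective one, so \<open>x\<close> and \<open>w\<close> are sums of two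
perspective pairs.
\<close>
lemma perspective_cantor_bernstein:
  fixes x w :: 'a
  assumes disj: "x \<sqinter> w = \<bottom>"
    and "perspective x w'" "w' \<le> w" "perspective w x'" "x' \<le> x"
  shows "perspective x w"
proof -
  obtain f f' where f: "segment_iso f f' x w'" "\<And>u. u \<le> x \<Longrightarrow> perspective u (f u)"
    using perspectivity[OF assms(2)] by blast
  obtain g g' where g: "segment_iso g g' w x'" "\<And>u. u \<le> w \<Longrightarrow> perspective u (g u)"
    using perspectivity[OF assms(4)] by blast
  have fle: "f u \<le> w" if "u \<le> x" for u
    using segment_iso_le[OF f(1) that] assms(3) by simp
  have gfle: "g (f u) \<le> x" if "u \<le> x" for u
    using segment_iso_le[OF g(1) fle[OF that]] assms(5) by simp
  have gfmono: "g (f u) \<le> g (f v)" if "u \<le> v" "v \<le> x" for u v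
    using segment_iso_mono[OF g(1) segment_iso_mono[OF f(1) that] fle[OF that(2)]] .
  obtain a0 where a0: "a0 \<le> x" "x' \<sqinter> a0 = \<bottom>" "x' \<squnion> a0 = x"
    using section_complement[OF assms(5)] by blast
  define A where "A n = ((\<lambda>u. a0 \<squnion> g (f u)) ^^ n) \<bottom>" for n
  have A_Suc: "A (Suc n) = a0 \<squnion> g (f (A n))" for n by (simp add: A_def)
  have A_le: "A n \<le> x" for n
  proof (induction n)
    case 0 then show ?case by (simp add: A_def)
  next
    case (Suc n) then show ?case using a0(1) gfle by (simp add: A_Suc)
  qed
  have A_inc: "A n \<le> A (Suc n)" for n
  proof (induction n)
    case 0 then show ?case by (simp add: A_def)
  next
    case (Suc n)
    then show ?case using gfmono[OF _ A_le] by (subst (1 2) A_Suc) (auto intro: le_supI2)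
  qed
  obtain B where B: "B \<le> x" "seq_lub A B" using seq_lub_exists[of A, OF A_inc A_le] by blast
  have gfB: "seq_lub (\<lambda>n. g (f (A n))) (g (f B))"
    using segment_iso_seq_lub[OF g(1) segment_iso_seq_lub[OF f(1) B(2,1)] fle[OF B(1)]] .
  have B_eq: "B = a0 \<squnion> g (f B)"
  proof (rule antisym)
    have "A n \<le> a0 \<squnion> g (f B)" for n
      using seq_lub_upper[OF gfB] by (cases n) (auto simp: A_def intro: le_supI2)
    then show "B \<le> a0 \<squnion> g (f B)" using seq_lub_least[OF B(2)] by blast
    have "g (f (A n)) \<le> B" for n
      using seq_lub_upper[OF B(2), of "Suc n"] by (simp add: A_Suc)
    then have "g (f B) \<le> B" using seq_lub_least[OF gfB] by blast
    moreover have "a0 \<le> B" using seq_lub_upper[OF B(2), of "Suc 0"] by (simp add: A_Suc)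
    ultimately show "a0 \<squnion> g (f B) \<le> B" by simp
  qed
  obtain r where r: "r \<le> w" "f B \<sqinter> r = \<bottom>" "f B \<squnion> r = w"
    using section_complement[OF fle[OF B(1)]] by blast
  have gx: "g (f B) \<squnion> g r = x'"
    using segment_iso_sup[OF g(1) fle[OF B(1)] r(1)] segment_iso_top[OF g(1)] r(3) by simp
  have "B \<squnion> g r = x"
    using B_eq gx a0(3) by (metis sup_assoc sup_commute)
  moreover have "B \<sqinter> g r = \<bottom>"
  proof -
    have "g r \<sqinter> g (f B) = \<bottom>"
      using segment_iso_disjoint[OF g(1) fle[OF B(1)] r(1,2)] by (simp add: inf_commute)
    moreover have "(g r \<squnion> g (f B)) \<sqinter> a0 = \<bottom>" using gx a0(2) by (simp add: sup_commute)
    ultimately have "g r \<sqinter> (g (f B) \<squnion> a0) = \<bottom>" by (rule disjoint_rotate)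
    then show ?thesis using B_eq by (simp add: ac_simps)
  qed
  moreover have "perspective B (f B)" using f(2) B(1) .
  moreover have "perspective (g r) r" using g(2)[OF r(1)] by (rule perspective_sym)
  ultimately show ?thesis
    using perspective_sum_disjoint[of B "f B" "g r" r] r(2,3) disj by simp
qed

text \<open>
Closure of the set of those \<open>u\<close> for which \<open>f u\<close> and \<open>g u\<close> are perspective under countable
independent sums, in the form required by the limit hypothesis of the next lemma.
\<close>
lemma segment_iso_perspective_seq_lub:
  fixes x :: 'a
  assumes f: "segment_iso f f' x y" and g: "segment_iso g g' x y'" and disj: "y \<sqinter> y' = \<bottom>"
    and le: "\<And>n. U n \<le> x"
    and start: "perspective (f (U 0)) (g (U 0))"
    and incr: "\<And>n. \<exists>u\<le>x. perspective (f u) (g u) \<and> U n \<sqinter> u = \<bottom> \<and> U (Suc n) = U n \<squnion> u"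
    and s: "seq_lub U s"
  shows "perspective (f s) (g s)"
proof -
  have sx: "s \<le> x" using seq_lub_least[OF s] le by blast
  have "\<exists>u v. perspective u v \<and> f (U n) \<sqinter> u = \<bottom> \<and> g (U n) \<sqinter> v = \<bottom> \<and>
      f (U (Suc n)) = f (U n) \<squnion> u \<and> g (U (Suc n)) = g (U n) \<squnion> v" for n
  proof -
    obtain u where "u \<le> x" "perspective (f u) (g u)" "U n \<sqinter> u = \<bottom>" "U (Suc n) = U n \<squnion> u"
      using incr by blast
    then show ?thesis
      using segment_iso_sup[OF f le] segment_iso_sup[OF g le]
        segment_iso_disjoint[OF f le] segment_iso_disjoint[OF g le] by metis
  qed
  moreover have "f s \<sqinter> g s = \<bottom>"
    using disjoint_mono[OF disj segment_iso_le[OF f sx] segment_iso_le[OF g sx]] .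
  ultimately show ?thesis
    using perspective_seq_lub[of "\<lambda>n. f (U n)" "\<lambda>n. g (U n)"] start
      segment_iso_seq_lub[OF f s sx] segment_iso_seq_lub[OF g s sx] by blast
qed

text \<open>
Start with a complement \<open>u0\<close> of \<open>x \<sqinter> z\<close> in \<open>x\<close> and keep adding \<open>\<theta> (U n) \<sqinter> x\<close>. Each increment \<open>u\<close>
lies below \<open>\<theta> (U n)\<close> and is disjoint from \<open>U n\<close>, hence \<open>\<theta> u\<close> is disjoint from \<open>\<theta> (U n)\<close> and so
from \<open>u\<close>: the property \<open>Q\<close> holds for all increments. By meet-continuity the limit \<open>s\<close> satisfies
\<open>s = u0 \<squnion> (x \<sqinter> \<theta> s)\<close>. Therefore a complement \<open>r\<close> of \<open>x \<sqinter> \<theta> s\<close> in \<open>x \<sqinter> z\<close> complements \<open>s\<close> in \<open>x\<close> and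
avoids \<open>\<theta> s\<close>.
\<close>
lemma displaced_part:
  fixes x z :: 'a
  assumes iso: "segment_iso \<theta> \<theta>' x z"
    and displaced: "\<And>u. u \<le> x \<Longrightarrow> u \<sqinter> \<theta> u = \<bottom> \<Longrightarrow> Q u"
    and limit: "\<And>U s. (\<And>n. U n \<le> x) \<Longrightarrow> Q (U 0) \<Longrightarrow>
      (\<And>n. \<exists>u\<le>x. Q u \<and> U n \<sqinter> u = \<bottom> \<and> U (Suc n) = U n \<squnion> u) \<Longrightarrow> seq_lub U s \<Longrightarrow> Q s"
  obtains s r where "s \<squnion> r = x" "s \<sqinter> r = \<bottom>" "Q s" "r \<le> z" "r \<sqinter> \<theta> s = \<bottom>"
proof -
  obtain u0 where u0: "u0 \<le> x" "(x \<sqinter> z) \<sqinter> u0 = \<bottom>" "(x \<sqinter> z) \<squnion> u0 = x"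
    using section_complement[of "x \<sqinter> z" x] by auto
  define U where "U n = ((\<lambda>u. u \<squnion> (\<theta> u \<sqinter> x)) ^^ n) u0" for n
  have U_Suc: "U (Suc n) = U n \<squnion> (\<theta> (U n) \<sqinter> x)" for n by (simp add: U_def)
  have U_le: "U n \<le> x" for n
    by (induction n) (use u0(1) in \<open>auto simp: U_Suc\<close>, simp add: U_def)
  have U_inc: "U n \<le> U (Suc n)" for n by (simp add: U_Suc)
  have "Q (U 0)"
  proof -
    have "u0 \<sqinter> \<theta> u0 \<le> (x \<sqinter> z) \<sqinter> u0"
      using u0(1) segment_iso_le[OF iso u0(1)] by (simp add: le_infI1 le_infI2)
    then show ?thesis using u0(1,2) displaced by (simp add: bot_unique U_def)
  qed
  moreover have "\<exists>u\<le>x. Q u \<and> U n \<sqinter> u = \<bottom> \<and> U (Suc n) = U n \<squnion> u" for n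
  proof -
    obtain u where u: "u \<le> \<theta> (U n) \<sqinter> x" "U n \<sqinter> u = \<bottom>" "U n \<squnion> u = U n \<squnion> (\<theta> (U n) \<sqinter> x)"
      using relative_complement by blast
    have "\<theta> (U n) \<sqinter> \<theta> u = \<bottom>"
      using segment_iso_disjoint[OF iso U_le _ u(2)] u(1) by simp
    then have "u \<sqinter> \<theta> u = \<bottom>" using u(1) by (auto intro: disjoint_mono)
    then show ?thesis using u displaced by (auto simp: U_Suc)
  qed
  moreover obtain s where s: "s \<le> x" "seq_lub U s" using seq_lub_exists[of U, OF U_inc U_le] by blast
  ultimately have "Q s" using limit U_le by blast
  have \<theta>s: "seq_lub (\<lambda>n. \<theta> (U n)) (\<theta> s)" using segment_iso_seq_lub[OF iso s(2,1)] .
  have \<theta>inc: "\<theta> (U n) \<le> \<theta> (U (Suc n))" for n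
    using segment_iso_mono[OF iso U_inc U_le] .
  have "x \<sqinter> \<theta> (U n) \<le> s" for n
    using seq_lub_upper[OF s(2), of "Suc n"] by (simp add: U_Suc inf_commute)
  then have fix_le: "x \<sqinter> \<theta> s \<le> s"
    using seq_lub_least[OF seq_lub_inf[of "\<lambda>n. \<theta> (U n)", OF \<theta>inc \<theta>s]] by blast
  have s_eq: "s = u0 \<squnion> (x \<sqinter> \<theta> s)"
  proof (rule antisym)
    have "U n \<le> u0 \<squnion> (x \<sqinter> \<theta> s)" for n
    proof (induction n)
      case 0 then show ?case by (simp add: U_def)
    next
      case (Suc n)
      have "\<theta> (U n) \<sqinter> x \<le> x \<sqinter> \<theta> s" using seq_lub_upper[OF \<theta>s] by (simp add: le_infI1)
      then show ?case using Suc by (simp add: U_Suc le_supI2)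
    qed
    then show "s \<le> u0 \<squnion> (x \<sqinter> \<theta> s)" using seq_lub_least[OF s(2)] by blast
    show "u0 \<squnion> (x \<sqinter> \<theta> s) \<le> s"
      using fix_le seq_lub_upper[OF s(2), of 0] by (simp add: U_def)
  qed
  have "x \<sqinter> \<theta> s \<le> x \<sqinter> z" using segment_iso_le[OF iso s(1)] by (simp add: le_infI2)
  then obtain r where r: "r \<le> x \<sqinter> z" "(x \<sqinter> \<theta> s) \<sqinter> r = \<bottom>" "(x \<sqinter> \<theta> s) \<squnion> r = x \<sqinter> z"
    using section_complement by blast
  have "s \<squnion> r = x" using s_eq r(3) u0(3) by (metis sup_assoc sup_commute)
  moreover have "s \<sqinter> r = \<bottom>"
  proof -
    have "r \<sqinter> (x \<sqinter> \<theta> s) = \<bottom>" using r(2) by (simp add: inf_commute)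
    moreover have "(r \<squnion> (x \<sqinter> \<theta> s)) \<sqinter> u0 = \<bottom>" using r(3) u0(2) by (simp add: sup_commute)
    ultimately have "r \<sqinter> ((x \<sqinter> \<theta> s) \<squnion> u0) = \<bottom>" by (rule disjoint_rotate)
    then show ?thesis using s_eq by (simp add: ac_simps)
  qed
  moreover have "r \<sqinter> \<theta> s = \<bottom>"
  proof -
    have "r \<sqinter> \<theta> s \<le> (x \<sqinter> \<theta> s) \<sqinter> r" using r(1) by (simp add: le_infI1)
    then show ?thesis using r(2) by (simp add: bot_unique)
  qed
  ultimately show ?thesis using that \<open>Q s\<close> r(1) by simp
qed

text \<open>
The displaced part \<open>s\<close> of \<open>x\<close> is sent to \<open>h (\<theta> s)\<close> and the remaining part \<open>r\<close>, which lies below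
\<open>z\<close>, to \<open>h r\<close>, where \<open>h\<close> is the perspectivity from \<open>z\<close> to \<open>w\<close>. So \<open>x\<close> is perspective to a part of
\<open>w\<close>. The same argument for the inverse of \<open>\<theta>\<close> makes \<open>w\<close> perspective to a part of \<open>x\<close>, and
Cantor-Bernstein applies.
\<close>
lemma perspective_shift:
  fixes x z w :: 'a
  assumes iso: "segment_iso \<theta> \<theta>' x z"
    and displaced: "\<And>u. u \<le> x \<Longrightarrow> u \<sqinter> \<theta> u = \<bottom> \<Longrightarrow> perspective u (\<theta> u)"
    and disj: "(x \<squnion> z) \<sqinter> w = \<bottom>" and "perspective z w"
  shows "perspective x w"
proof -
  obtain h h' where h: "segment_iso h h' z w" "\<And>u. u \<le> z \<Longrightarrow> perspective u (h u)"
    using perspectivity[OF \<open>perspective z w\<close>] by blast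
  note iso' = segment_iso_sym[OF iso]
  have xw: "x \<sqinter> w = \<bottom>" using disj by (rule disjoint_mono) auto
  have "\<exists>w'\<le>w. perspective x w'"
  proof -
    note h\<theta> = segment_iso_trans[OF iso h(1)]
    have 1: "perspective u (h (\<theta> u))" if "u \<le> x" "u \<sqinter> \<theta> u = \<bottom>" for u
    proof (rule perspective_trans_independent[OF displaced[OF that]])
      have z: "\<theta> u \<le> z" using segment_iso_le[OF iso that(1)] .
      then show "perspective (\<theta> u) (h (\<theta> u))" by (rule h(2))
      show "(u \<squnion> \<theta> u) \<sqinter> h (\<theta> u) = \<bottom>"
        using disj by (rule disjoint_mono) (use that(1) z segment_iso_le[OF h(1) z] in \<open>auto intro: le_supI1 le_supI2\<close>)
    qed
    obtain s r where sr: "s \<squnion> r = x" "s \<sqinter> r = \<bottom>" "perspective s (h (\<theta> s))" "r \<le> z" "r \<sqinter> \<theta> s = \<bottom>"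
    proof (rule displaced_part[OF iso, of "\<lambda>u. perspective u (h (\<theta> u))"])
      show "perspective s (h (\<theta> s))"
        if "\<And>n. U n \<le> x" "perspective (U 0) (h (\<theta> (U 0)))"
          "\<And>n. \<exists>u\<le>x. perspective u (h (\<theta> u)) \<and> U n \<sqinter> u = \<bottom> \<and> U (Suc n) = U n \<squnion> u" "seq_lub U s"
        for U s
        using segment_iso_perspective_seq_lub[OF segment_iso_refl h\<theta> xw, of U s] that by blast
    qed (use 1 in blast)+
    have sx: "s \<le> x" "r \<le> x" using sr(1) by auto
    have \<theta>s: "\<theta> s \<le> z" using segment_iso_le[OF iso sx(1)] .
    have "h (\<theta> s) \<sqinter> h r = \<bottom>"
      using segment_iso_disjoint[OF h(1) \<theta>s sr(4)] sr(5) by (simp add: inf_commute)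
    moreover have w: "h (\<theta> s) \<squnion> h r \<le> w"
      using segment_iso_le[OF h(1)] \<theta>s sr(4) by simp
    moreover have "(s \<squnion> r) \<sqinter> (h (\<theta> s) \<squnion> h r) = \<bottom>"
      using xw by (rule disjoint_mono) (use sr(1) w in auto)
    ultimately have "perspective (s \<squnion> r) (h (\<theta> s) \<squnion> h r)"
      using perspective_sum_disjoint[OF sr(3) h(2)[OF sr(4)] sr(2)] by blast
    then show ?thesis using w sr(1) by blast
  qed
  moreover have "\<exists>x'\<le>x. perspective w x'"
  proof -
    have 1: "perspective (h v) (\<theta>' v)" if "v \<le> z" "v \<sqinter> \<theta>' v = \<bottom>" for v
    proof -
      have v: "\<theta>' v \<le> x" "\<theta> (\<theta>' v) = v"
        using segment_iso_le[OF iso' that(1)] segment_iso_inverse[OF iso' that(1)] by auto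
      have "perspective (\<theta>' v) (h v)"
      proof (rule perspective_trans_independent)
        show "perspective (\<theta>' v) v" using displaced[OF v(1)] v(2) that(2) by (simp add: inf_commute)
        show "perspective v (h v)" using h(2)[OF that(1)] .
        show "(\<theta>' v \<squnion> v) \<sqinter> h v = \<bottom>"
          using disj by (rule disjoint_mono) (use that(1) v segment_iso_le[OF h(1)] in \<open>auto intro: le_supI1 le_supI2\<close>)
      qed
      then show ?thesis by (rule perspective_sym)
    qed
    have wx: "w \<sqinter> x = \<bottom>" using xw by (simp add: inf_commute)
    obtain s r where sr: "s \<squnion> r = z" "s \<sqinter> r = \<bottom>" "perspective (h s) (\<theta>' s)" "r \<le> x" "r \<sqinter> \<theta>' s = \<bottom>"
    proof (rule displaced_part[OF iso', of "\<lambda>v. perspective (h v) (\<theta>' v)"])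
      show "perspective (h s) (\<theta>' s)"
        if "\<And>n. U n \<le> z" "perspective (h (U 0)) (\<theta>' (U 0))"
          "\<And>n. \<exists>u\<le>z. perspective (h u) (\<theta>' u) \<and> U n \<sqinter> u = \<bottom> \<and> U (Suc n) = U n \<squnion> u" "seq_lub U s"
        for U s
        using segment_iso_perspective_seq_lub[OF h(1) iso' wx, of U s] that by blast
    qed (use 1 in blast)+
    have sz: "s \<le> z" "r \<le> z" using sr(1) by auto
    have "h s \<sqinter> h r = \<bottom>" using segment_iso_disjoint[OF h(1) sz sr(2)] .
    moreover have hw: "h s \<squnion> h r = w"
      using segment_iso_sup[OF h(1) sz] sr(1) segment_iso_top[OF h(1)] by simp
    moreover have x: "\<theta>' s \<squnion> r \<le> x" using segment_iso_le[OF iso' sz(1)] sr(4) by simp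
    moreover have "(h s \<squnion> h r) \<sqinter> (\<theta>' s \<squnion> r) = \<bottom>"
      using wx by (rule disjoint_mono) (use hw x in auto)
    moreover have "\<theta>' s \<sqinter> r = \<bottom>" using sr(5) by (simp add: inf_commute)
    ultimately have "perspective (h s \<squnion> h r) (\<theta>' s \<squnion> r)"
      using perspective_sum_disjoint[OF sr(3) perspective_sym[OF h(2)[OF sz(2)]]] by blast
    then show ?thesis using x hw by (intro exI[of _ "\<theta>' s \<squnion> r"]) simp
  qed
  ultimately show ?thesis using perspective_cantor_bernstein[OF xw] by blast
qed

section \<open>Disjoint projective elements are perspective\<close>
text \<open>
An \<open>r\<close> below \<open>a \<oplus> c\<close> that is disjoint from \<open>a\<close> and \<open>c\<close> is the graph of an isomorphism between its
projections to \<open>a\<close> and to \<open>c\<close>. The shift principle is applied to \<open>T\<close> followed by the projection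
\<open>?P\<close> of \<open>r\<close> to \<open>a\<close> along the axis \<open>c\<close>. This is an isomorphism between segments below \<open>a\<close> that
moves each \<open>u\<close> through the chain \<open>u \<sim> T u \<sim> ?P (T u)\<close>. If \<open>u\<close> is disjoint from \<open>?P (T u)\<close>, then
it is disjoint from \<open>T u \<squnion> ?P (T u)\<close>, as this lies below \<open>?P (T u) \<squnion> c\<close>.
\<close>
lemma perspective_shift_along_graph:
  fixes a :: 'a
  assumes ac: "a \<sqinter> c = \<bottom>" and r: "r \<le> a \<squnion> c" "r \<sqinter> a = \<bottom>" "r \<sqinter> c = \<bottom>"
    and iso: "segment_iso T T' x r" and T: "\<And>u. u \<le> x \<Longrightarrow> perspective u (T u)"
    and x: "x \<le> a" and w: "w \<le> c" "perspective (a \<sqinter> (r \<squnion> c)) w"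
  shows "perspective x w"
proof -
  define a' where "a' = a \<sqinter> (r \<squnion> c)"
  have "c \<squnion> a' = (c \<squnion> a) \<sqinter> (r \<squnion> c)" unfolding a'_def by (rule modular) simp
  then have j: "r \<squnion> c = a' \<squnion> c" using r(1) by (simp add: ac_simps inf.absorb2)
  have a'c: "a' \<sqinter> c = \<bottom>" using ac unfolding a'_def by (rule disjoint_mono) auto
  note p = perspective_segment_iso[OF r(3) a'c j]
  let ?P = "\<lambda>u. (u \<squnion> c) \<sqinter> a'"
  show ?thesis
  proof (rule perspective_shift)
    show "segment_iso (\<lambda>u. ?P (T u)) (\<lambda>u. T' ((u \<squnion> c) \<sqinter> r)) x a'"
      using segment_iso_trans[OF iso p(1)] .
    show "perspective u (?P (T u))" if u: "u \<le> x" "u \<sqinter> ?P (T u) = \<bottom>" for u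
    proof (rule perspective_trans_independent'[OF T[OF u(1)]])
      have Tu: "T u \<le> r" using segment_iso_le[OF iso u(1)] .
      show "perspective (T u) (?P (T u))" using p(3)[OF Tu] .
      have "T u \<squnion> ?P (T u) \<le> ?P (T u) \<squnion> c"
        using p(2)[OF Tu] by (metis sup_ge1 le_supI)
      moreover have "u \<sqinter> (?P (T u) \<squnion> c) \<le> ?P (T u)"
      proof -
        have "u \<sqinter> (?P (T u) \<squnion> c) \<le> a \<sqinter> (?P (T u) \<squnion> c)" using u(1) x by (meson inf_mono order_refl order_trans)
        also have "\<dots> = ?P (T u) \<squnion> (c \<sqinter> a)"
          by (rule modular_inf_sup) (simp add: a'_def le_infI2)
        finally show ?thesis using ac by (simp add: inf_commute)
      qed
      ultimately have "u \<sqinter> (T u \<squnion> ?P (T u)) \<le> u \<sqinter> ?P (T u)"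
        by (meson inf.bounded_iff inf_le1 inf_mono order_refl order_trans)
      then show "u \<sqinter> (T u \<squnion> ?P (T u)) = \<bottom>" using u(2) by (simp add: bot_unique)
    qed
    show "(x \<squnion> a') \<sqinter> w = \<bottom>" using ac by (rule disjoint_mono) (use x w in \<open>auto simp: a'_def\<close>)
    show "perspective a' w" using w(2) by (simp add: a'_def)
  qed
qed

text \<open>
It suffices to split \<open>b\<close> into summands \<open>u\<close> whose images \<open>S u\<close> below \<open>a\<close> and \<open>T u\<close> below \<open>c\<close> are
perspective. The summands are \<open>p = b \<sqinter> a\<close>, \<open>q = b \<sqinter> c\<close>, a complement \<open>b2\<close> of \<open>b \<sqinter> (a \<squnion> c)\<close>, and a
rest \<open>r\<close> below \<open>a \<squnion> c\<close> that is disjoint from \<open>a\<close> and \<open>c\<close>. For \<open>p\<close> the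
elements \<open>S p\<close> and \<open>p\<close> lie below \<open>a\<close> and \<open>T p\<close> below \<open>c\<close>, for \<open>q\<close> it is the other way round, and
\<open>b2\<close> is independent of its two images; so independent transitivity applies to these three. For \<open>r\<close>, one shifts
twice: from \<open>T r\<close> to the projection of \<open>r\<close> to \<open>a\<close>, and then from \<open>S r\<close> to \<open>T r\<close>.
\<close>
lemma perspective_trans_disjoint:
  fixes a b c :: 'a
  assumes ab: "perspective a b" and bc: "perspective b c" and ac: "a \<sqinter> c = \<bottom>"
  shows "perspective a c"
proof -
  obtain S S' where S: "segment_iso S S' b a" "\<And>u. u \<le> b \<Longrightarrow> perspective u (S u)"
    using perspectivity[OF perspective_sym[OF ab]] by blast
  obtain T T' where T: "segment_iso T T' b c" "\<And>u. u \<le> b \<Longrightarrow> perspective u (T u)"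
    using perspectivity[OF bc] by blast
  note S_le = segment_iso_le[OF S(1)]
  note T_le = segment_iso_le[OF T(1)]
  have good_sum: "perspective (S (u \<squnion> v)) (T (u \<squnion> v))"
    if "perspective (S u) (T u)" "perspective (S v) (T v)" "u \<le> b" "v \<le> b" "u \<sqinter> v = \<bottom>" for u v
  proof -
    have "(S u \<squnion> S v) \<sqinter> (T u \<squnion> T v) = \<bottom>"
      using ac by (rule disjoint_mono) (use that S_le T_le in auto)
    then show ?thesis
      using perspective_sum_disjoint[OF that(1,2)] segment_iso_disjoint[OF S(1) that(3,4,5)]
        segment_iso_disjoint[OF T(1) that(3,4,5)] segment_iso_sup[OF S(1) that(3,4)]
        segment_iso_sup[OF T(1) that(3,4)] by simp
  qed
  define p where "p = b \<sqinter> a"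
  define q where "q = b \<sqinter> c"
  define b1 where "b1 = b \<sqinter> (a \<squnion> c)"
  obtain b2 where b2: "b2 \<le> b" "b1 \<sqinter> b2 = \<bottom>" "b1 \<squnion> b2 = b"
    using section_complement[of b1 b] by (auto simp: b1_def)
  have "p \<squnion> q \<le> b1" unfolding p_def q_def b1_def by (simp add: le_infI2 le_supI1 le_supI2)
  then obtain r where r: "r \<le> b1" "(p \<squnion> q) \<sqinter> r = \<bottom>" "(p \<squnion> q) \<squnion> r = b1"
    using section_complement by blast
  have le: "p \<le> b" "q \<le> b" "r \<le> b" "b1 \<le> b" "p \<le> a" "q \<le> c" "r \<le> a \<squnion> c"
    using r(1) unfolding p_def q_def b1_def by auto
  have pq: "p \<sqinter> q = \<bottom>" using ac by (rule disjoint_mono) (use le in auto)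
  have "perspective (S b2) (T b2)"
  proof (rule perspective_trans_independent)
    show "perspective (S b2) b2" using perspective_sym[OF S(2)[OF b2(1)]] .
    show "perspective b2 (T b2)" using T(2)[OF b2(1)] .
    have "b2 \<sqinter> (S b2 \<squnion> T b2) \<le> b1 \<sqinter> b2"
      using S_le[OF b2(1)] T_le[OF b2(1)] b2(1) unfolding b1_def
      by (meson inf_le1 inf_le2 le_infI le_supI1 le_supI2 order_trans sup_mono)
    then have "(T b2 \<squnion> S b2) \<sqinter> b2 = \<bottom>" using b2(2) by (simp add: bot_unique ac_simps)
    moreover have "T b2 \<sqinter> S b2 = \<bottom>"
      using disjoint_mono[OF ac S_le[OF b2(1)] T_le[OF b2(1)]] by (simp add: inf_commute)
    ultimately have "T b2 \<sqinter> (S b2 \<squnion> b2) = \<bottom>" by (intro disjoint_rotate)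
    then show "(S b2 \<squnion> b2) \<sqinter> T b2 = \<bottom>" by (simp add: inf_commute)
  qed
  moreover have "perspective (S p) (T p)"
  proof (rule perspective_trans_independent)
    show "perspective (S p) p" using perspective_sym[OF S(2)[OF le(1)]] .
    show "perspective p (T p)" using T(2)[OF le(1)] .
    show "(S p \<squnion> p) \<sqinter> T p = \<bottom>"
      using ac by (rule disjoint_mono) (use le S_le T_le in auto)
  qed
  moreover have "perspective (S q) (T q)"
  proof (rule perspective_trans_independent')
    show "perspective (S q) q" using perspective_sym[OF S(2)[OF le(2)]] .
    show "perspective q (T q)" using T(2)[OF le(2)] .
    show "S q \<sqinter> (q \<squnion> T q) = \<bottom>"
      using ac by (rule disjoint_mono) (use le S_le T_le in auto)
  qed
  moreover have "perspective (S r) (T r)"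
  proof -
    have ca: "c \<sqinter> a = \<bottom>" using ac by (simp add: inf_commute)
    have ra: "r \<sqinter> a = \<bottom>"
    proof -
      have "r \<sqinter> a \<le> (p \<squnion> q) \<sqinter> r" using le(3) unfolding p_def
        by (meson inf_le1 inf_le2 le_infI le_supI1 order_trans)
      then show ?thesis using r(2) by (simp add: bot_unique)
    qed
    have rc: "r \<sqinter> c = \<bottom>"
    proof -
      have "r \<sqinter> c \<le> (p \<squnion> q) \<sqinter> r" using le(3) unfolding q_def
        by (meson inf_le1 inf_le2 le_infI le_supI2 order_trans)
      then show ?thesis using r(2) by (simp add: bot_unique)
    qed
    let ?a = "a \<sqinter> (r \<squnion> c)" and ?c = "c \<sqinter> (r \<squnion> a)"
    \<comment> \<open>The graph \<open>r\<close> itself is an axis for its two projections.\<close>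
    have "perspective ?c ?a"
    proof (rule perspectiveI)
      show "?c \<sqinter> r = \<bottom>" using rc by (auto intro: disjoint_mono simp: inf_commute[of _ r])
      show "?a \<sqinter> r = \<bottom>" using ra by (auto intro: disjoint_mono simp: inf_commute[of _ r])
      have "r \<squnion> ?c = (r \<squnion> c) \<sqinter> (r \<squnion> a)" "r \<squnion> ?a = (r \<squnion> a) \<sqinter> (r \<squnion> c)"
        by (rule modular; simp)+
      then show "?c \<squnion> r = ?a \<squnion> r" by (simp add: ac_simps)
    qed
    moreover have "segment_iso (\<lambda>u. T' u) T (T r) r"
      using segment_iso_sym[OF segment_iso_restrict[OF T(1) le(3)]] .
    moreover have "perspective u (T' u)" if "u \<le> T r" for u
    proof -
      have "u \<le> c" using that T_le[OF le(3)] by simp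
      then show ?thesis
        using T(2) segment_iso_le[OF segment_iso_sym[OF T(1)]]
          segment_iso_inverse[OF segment_iso_sym[OF T(1)]] perspective_sym by metis
    qed
    ultimately have 1: "perspective (T r) ?a"
      using perspective_shift_along_graph[OF ca _ rc ra, of T' T "T r" ?a] T_le[OF le(3)] le(7)
      by (simp add: sup_commute)
    have "segment_iso (\<lambda>u. S' u) S (S r) r"
      using segment_iso_sym[OF segment_iso_restrict[OF S(1) le(3)]] .
    moreover have "perspective u (S' u)" if "u \<le> S r" for u
    proof -
      have "u \<le> a" using that S_le[OF le(3)] by simp
      then show ?thesis
        using S(2) segment_iso_le[OF segment_iso_sym[OF S(1)]]
          segment_iso_inverse[OF segment_iso_sym[OF S(1)]] perspective_sym by metis
    qed
    ultimately show ?thesis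
      using perspective_shift_along_graph[OF ac le(7) ra rc, of S' S "S r" "T r"]
        S_le[OF le(3)] T_le[OF le(3)] perspective_sym[OF 1] by simp
  qed
  ultimately have "perspective (S (p \<squnion> q \<squnion> r \<squnion> b2)) (T (p \<squnion> q \<squnion> r \<squnion> b2))"
    using le b2 r pq by (intro good_sum) simp_all
  then show ?thesis using r(3) b2(3) segment_iso_top[OF S(1)] segment_iso_top[OF T(1)] by simp
qed

text \<open>
Let \<open>a \<sim> b\<close>, with \<open>n\<close> more steps from \<open>b\<close> to \<open>c\<close>, and split \<open>b\<close> into \<open>y = b \<sqinter> c\<close> and a complement
\<open>z\<close>. As \<open>z\<close> is disjoint from its image in \<open>c\<close>, the induction hypothesis makes them perspective, which
leaves only two steps. As \<open>y\<close> and its image \<open>T y\<close> both lie below \<open>c\<close> and \<open>y\<close> is perspective to its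
image below \<open>a\<close>, the shift principle applies to the inverse of \<open>T\<close>; its hypothesis on displaced
elements is again the induction hypothesis.
\<close>
lemma projective_disjoint_imp_perspective:
  fixes a c :: 'a
  assumes "(perspective ^^ n) a c" "a \<sqinter> c = \<bottom>"
  shows "perspective a c"
  using assms
proof (induction n arbitrary: a c)
  case 0
  then show ?case by (simp add: perspective_refl)
next
  case (Suc n)
  obtain b where ab: "perspective a b" and bc: "(perspective ^^ n) b c"
    using Suc.prems(1) by (meson relpowp_Suc_E2)
  obtain S S' where S: "segment_iso S S' b a" "\<And>u. u \<le> b \<Longrightarrow> perspective u (S u)"
    using perspectivity[OF perspective_sym[OF ab]] by blast
  obtain T T' where T: "segment_iso T T' b c" "\<And>u. u \<le> b \<Longrightarrow> (perspective ^^ n) u (T u)"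
    using projectivity[OF bc] by blast
  note S_le = segment_iso_le[OF S(1)]
  note T_le = segment_iso_le[OF T(1)]
  define y where "y = b \<sqinter> c"
  obtain z where z: "z \<le> b" "y \<sqinter> z = \<bottom>" "y \<squnion> z = b"
    using section_complement[of y b] by (auto simp: y_def)
  have y: "y \<le> b" "y \<le> c" by (simp_all add: y_def)
  have "perspective (S z) (T z)"
  proof (rule perspective_trans_disjoint)
    show "perspective (S z) z" using perspective_sym[OF S(2)[OF z(1)]] .
    have "z \<sqinter> T z \<le> y \<sqinter> z" using T_le[OF z(1)] z(1) unfolding y_def by (simp add: le_infI1 le_infI2)
    then show "perspective z (T z)" using Suc.IH[OF T(2)[OF z(1)]] z(2) by (simp add: bot_unique)
    show "S z \<sqinter> T z = \<bottom>" using disjoint_mono[OF Suc.prems(2) S_le[OF z(1)] T_le[OF z(1)]] .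
  qed
  moreover have "perspective (S y) (T y)"
  proof -
    have "perspective (T y) (S y)"
    proof (rule perspective_shift)
      show "segment_iso T' T (T y) y"
        using segment_iso_sym[OF segment_iso_restrict[OF T(1) y(1)]] .
      show "perspective u (T' u)" if u: "u \<le> T y" "u \<sqinter> T' u = \<bottom>" for u
      proof -
        have "u \<le> c" using u(1) T_le[OF y(1)] by simp
        then have "(perspective ^^ n) (T' u) u"
          using T(2) segment_iso_le[OF segment_iso_sym[OF T(1)]]
            segment_iso_inverse[OF segment_iso_sym[OF T(1)]] by metis
        then show ?thesis using Suc.IH[OF projective_sym] u(2) by simp
      qed
      show "(T y \<squnion> y) \<sqinter> S y = \<bottom>"
      proof -
        have "c \<sqinter> a = \<bottom>" using Suc.prems(2) by (simp add: inf_commute)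
        then show ?thesis by (rule disjoint_mono) (use S_le T_le y in auto)
      qed
      show "perspective y (S y)" using S(2)[OF y(1)] .
    qed
    then show ?thesis by (rule perspective_sym)
  qed
  moreover have "S y \<squnion> S z = a" "T y \<squnion> T z = c"
    using segment_iso_sup[OF S(1) y(1) z(1)] segment_iso_sup[OF T(1) y(1) z(1)]
      segment_iso_top[OF S(1)] segment_iso_top[OF T(1)] z(3) by auto
  moreover have "S y \<sqinter> S z = \<bottom>" "T y \<sqinter> T z = \<bottom>"
    using segment_iso_disjoint[OF S(1) y(1) z(1,2)] segment_iso_disjoint[OF T(1) y(1) z(1,2)] .
  ultimately show ?case
    using perspective_sum_disjoint[of "S y" "T y" "S z" "T z"] Suc.prems(2) by simp
qed

end

section \<open>Existence\<close>

text \<open>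
No rule for transitivity is included: induction then yields decompositions into finitely many
projective pairs, which are all that the perspectivity of disjoint related elements needs.
\<close>
inductive piecewise_projective ::
  "'a::bounded_lattice_bot \<Rightarrow> 'a \<Rightarrow> bool" where
  projective: "(perspective ^^ n) x y \<Longrightarrow> piecewise_projective x y"
| sum: "piecewise_projective x x' \<Longrightarrow> piecewise_projective y y' \<Longrightarrow>
     is_oplus z x y \<Longrightarrow> is_oplus z' x' y' \<Longrightarrow> piecewise_projective z z'"

lemma piecewise_projective_sym: "piecewise_projective x y \<Longrightarrow> piecewise_projective y x"
  by (induction rule: piecewise_projective.induct)
     (auto intro: piecewise_projective.intros projective_sym)

lemma perspective_imp_piecewise_projective: "perspective x y \<Longrightarrow> piecewise_projective x y"
  by (rule piecewise_projective.projective[of 1]) auto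

lemma segment_iso_oplus:
  assumes "segment_iso f g x y" "is_oplus x x0 x1"
  shows "is_oplus y (f x0) (f x1)" "x0 \<le> x" "x1 \<le> x"
proof -
  show le: "x0 \<le> x" "x1 \<le> x" using assms(2) by (auto simp: is_oplus_def)
  show "is_oplus y (f x0) (f x1)"
    using assms segment_iso_disjoint[OF assms(1) le] segment_iso_sup[OF assms(1) le]
      segment_iso_top[OF assms(1)] by (auto simp: is_oplus_def perp_def)
qed

lemma piecewise_projective_trans_projective:
  fixes x y z :: "'a::{sectionally_complemented_lattice, modular_lattice}"
  assumes "piecewise_projective x y" "(perspective ^^ n) y z"
  shows "piecewise_projective x z"
  using assms
proof (induction arbitrary: z rule: piecewise_projective.induct)
  case (projective m x y)
  then have "(perspective ^^ (m + n)) x z" by (auto simp: relpowp_add)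
  then show ?case by (rule piecewise_projective.projective)
next
  case (sum x x' y y' w w')
  obtain f g where f: "segment_iso f g w' z" "\<forall>u\<le>w'. (perspective ^^ n) u (f u)"
    using projectivity[OF sum.prems] by blast
  note * = segment_iso_oplus[OF f(1) sum.hyps(4)]
  show ?case
    using piecewise_projective.sum[OF sum.IH(1) sum.IH(2) sum.hyps(3) *(1)] f(2) *(2,3) by blast
qed

lemma piecewise_projective_trans_perspective:
  fixes x y z :: "'a::{sectionally_complemented_lattice, modular_lattice}"
  assumes "piecewise_projective x y" "perspective y z"
  shows "piecewise_projective x z"
  using piecewise_projective_trans_projective[of x y 1 z] assms by auto

text \<open>
In the inductive case \<open>x\<close> carries the given decomposition \<open>s \<oplus> t\<close> and the decomposition \<open>p \<oplus> q\<close> of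
the last rule. Their common refinement reduces the claim to \<open>p\<close> and \<open>q\<close>, up to a perspectivity that
is absorbed on the right.
\<close>
lemma piecewise_projective_refining:
  fixes x y :: "'a::{sectionally_complemented_lattice, modular_lattice}"
  assumes "piecewise_projective y x" "is_oplus x s t"
  shows "\<exists>y0 y1. piecewise_projective y0 s \<and> piecewise_projective y1 t \<and> is_oplus y y0 y1"
  using assms
proof (induction arbitrary: s t rule: piecewise_projective.induct)
  case (projective n y x)
  obtain f g where f: "segment_iso f g x y" "\<forall>u\<le>x. (perspective ^^ n) u (f u)"
    using projectivity[OF projective_sym[OF projective.hyps]] by blast
  note * = segment_iso_oplus[OF f(1) projective.prems]
  have "piecewise_projective (f s) s" "piecewise_projective (f t) t"
    using f(2) *(2,3) piecewise_projective.projective piecewise_projective_sym by blast+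
  then show ?case using *(1) by blast
next
  case (sum y1 p y2 q y x)
  have "p \<sqinter> q = \<bottom>" "s \<sqinter> t = \<bottom>" "p \<squnion> q = s \<squnion> t"
    using sum.hyps(4) sum.prems by (auto simp: is_oplus_def perp_def)
  then obtain p' s' w where ref: "is_oplus p (p \<sqinter> s) p'" "is_oplus s (p \<sqinter> s) s'"
    "perp s' w" "perp p' w" "perspective q (s' \<squnion> w)" "perspective t (p' \<squnion> w)"
    by (rule common_refinement)
  obtain f g where f: "segment_iso f g (s' \<squnion> w) q" "\<And>u. u \<le> s' \<squnion> w \<Longrightarrow> perspective u (f u)"
    using perspectivity[OF perspective_sym[OF ref(5)]] by blast
  have "is_oplus (s' \<squnion> w) s' w" using ref(3) by (simp add: is_oplus_def)
  note q = segment_iso_oplus(1)[OF f(1) this]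
  obtain y11 y12 where y1: "piecewise_projective y11 (p \<sqinter> s)" "piecewise_projective y12 p'"
    "is_oplus y1 y11 y12" using sum.IH(1)[OF ref(1)] by blast
  obtain y21 y22 where y2: "piecewise_projective y21 (f s')" "piecewise_projective y22 (f w)"
    "is_oplus y2 y21 y22" using sum.IH(2)[OF q] by blast
  have 1: "piecewise_projective y21 s'" "piecewise_projective y22 w"
    using y2(1,2) f(2) perspective_sym piecewise_projective_trans_perspective
    by (metis sup_ge1, metis sup_ge2)
  have dis: "(y11 \<squnion> y12) \<sqinter> (y21 \<squnion> y22) = \<bottom>" "y11 \<sqinter> y12 = \<bottom>" "y21 \<sqinter> y22 = \<bottom>"
    and y: "y = (y11 \<squnion> y12) \<squnion> (y21 \<squnion> y22)"
    using y1(3) y2(3) sum.hyps(3) by (auto simp: is_oplus_def perp_def)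
  have "(y11 \<squnion> y21) \<sqinter> (y12 \<squnion> y22) = \<bottom>" using disjoint_sums[OF dis(1)] dis(2,3) by simp
  then have "is_oplus y (y11 \<squnion> y21) (y12 \<squnion> y22)"
    using y by (simp add: is_oplus_def perp_def ac_simps)
  moreover have "is_oplus (y11 \<squnion> y21) y11 y21" "is_oplus (y12 \<squnion> y22) y12 y22"
    using dis(1) by (auto simp: is_oplus_def perp_def intro: disjoint_mono)
  moreover from this(1) have "piecewise_projective (y11 \<squnion> y21) s"
    using piecewise_projective.sum[OF y1(1) 1(1)] ref(2) by blast
  moreover have "is_oplus (p' \<squnion> w) p' w" using ref(4) by (simp add: is_oplus_def)
  then have "piecewise_projective (y12 \<squnion> y22) (p' \<squnion> w)"
    using piecewise_projective.sum[OF y1(2) 1(2) \<open>is_oplus (y12 \<squnion> y22) y12 y22\<close>] by blast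
  then have "piecewise_projective (y12 \<squnion> y22) t"
    using ref(6) perspective_sym piecewise_projective_trans_perspective by blast
  ultimately show ?case by blast
qed

lemma piecewise_projective_trans:
  fixes x y z :: "'a::{sectionally_complemented_lattice, modular_lattice}"
  assumes "piecewise_projective y z" "piecewise_projective x y"
  shows "piecewise_projective x z"
  using assms
proof (induction arbitrary: x rule: piecewise_projective.induct)
  case (projective n y z)
  then show ?case using piecewise_projective_trans_projective by blast
next
  case (sum y1 z1 y2 z2 y z)
  then show ?case using piecewise_projective_refining piecewise_projective.sum by meson
qed

lemma normal_equivalence_piecewise_projective:
  assumes cont: "conditionally_aleph0_meet_continuous
    TYPE('a::{sectionally_complemented_lattice, modular_lattice})"
  shows "normal_equivalence (piecewise_projective :: 'a \<Rightarrow> 'a \<Rightarrow> bool)"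
  unfolding normal_equivalence_def
proof (intro conjI allI impI)
  show "equivp (piecewise_projective :: 'a \<Rightarrow> 'a \<Rightarrow> bool)"
    using piecewise_projective_sym piecewise_projective_trans
      perspective_imp_piecewise_projective[OF perspective_refl]
    by (intro equivpI reflpI sympI transpI) blast+
  show "additive (piecewise_projective :: 'a \<Rightarrow> 'a \<Rightarrow> bool)"
    unfolding additive_def using piecewise_projective.sum by blast
  show "refining (piecewise_projective :: 'a \<Rightarrow> 'a \<Rightarrow> bool)"
    unfolding refining_def using piecewise_projective_refining by blast
  show "piecewise_projective x y" if "perspective x y" for x y :: 'a
    using that by (rule perspective_imp_piecewise_projective)
  show "perspective x y" if "perp x y \<and> piecewise_projective x y" for x y :: 'a
  proof -
    have "piecewise_projective x y" "x \<sqinter> y = \<bottom>" using that by (auto simp: perp_def)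
    then show ?thesis
    proof (induction rule: piecewise_projective.induct)
      case (projective n x y)
      then show ?case using projective_disjoint_imp_perspective[OF cont] by blast
    next
      case (sum x x' y y' z z')
      have d: "x \<sqinter> y = \<bottom>" "x' \<sqinter> y' = \<bottom>" "z = x \<squnion> y" "z' = x' \<squnion> y'"
        using sum.hyps(3,4) by (auto simp: is_oplus_def perp_def)
      have "x \<sqinter> x' = \<bottom>" "y \<sqinter> y' = \<bottom>"
        using sum.prems d(3,4) by (auto intro: disjoint_mono)
      then show ?case
        using perspective_sum_disjoint[OF sum.IH d(1,2)] sum.prems d(3,4) by simp
    qed
  qed
qed

section \<open>Independent sequences\<close>

primrec partial_join :: "(nat \<Rightarrow> 'a::bounded_lattice_bot) \<Rightarrow> nat \<Rightarrow> 'a" where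
  "partial_join u 0 = \<bottom>"
| "partial_join u (Suc n) = partial_join u n \<squnion> u n"

text \<open>
Independence is required only of each term from the preceding ones; in a modular lattice this
already gives independence of disjoint finite sets of indices.
\<close>
definition independent_seq :: "(nat \<Rightarrow> 'a::bounded_lattice_bot) \<Rightarrow> bool" where
  "independent_seq u \<longleftrightarrow> (\<forall>n. partial_join u n \<sqinter> u n = \<bottom>)"

lemma partial_join_le: "(\<And>n. u n \<le> b) \<Longrightarrow> partial_join u n \<le> b"
  by (induction n) auto

lemma seq_lub_partial_join: "seq_lub (partial_join u) s \<longleftrightarrow> seq_lub u s"
proof -
  have "(\<forall>n. partial_join u n \<le> b) \<longleftrightarrow> (\<forall>n. u n \<le> b)" for b
    by (metis partial_join.simps(2) partial_join_le le_sup_iff)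
  then show ?thesis by (simp add: seq_lub_def)
qed

lemma partial_join_sup:
  "partial_join (\<lambda>n. p n \<squnion> q n) n = partial_join p n \<squnion> partial_join q n"
  by (induction n) (simp_all add: ac_simps)

lemma independent_pairs:
  fixes p q :: "nat \<Rightarrow> 'a::{bounded_lattice_bot, modular_lattice}"
  assumes "independent_seq (\<lambda>n. p n \<squnion> q n)" "\<And>n. p n \<sqinter> q n = \<bottom>"
  shows "independent_seq p" "independent_seq q" "partial_join p n \<sqinter> partial_join q n = \<bottom>"
proof -
  have *: "(partial_join p n \<squnion> partial_join q n) \<sqinter> (p n \<squnion> q n) = \<bottom>" for n
    using assms(1) by (simp add: independent_seq_def partial_join_sup)
  have "partial_join p n \<sqinter> p n = \<bottom>" "partial_join q n \<sqinter> q n = \<bottom>" for n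
    by (rule disjoint_mono[OF *[of n]]; simp)+
  then show "independent_seq p" "independent_seq q" by (simp_all add: independent_seq_def)
  show "partial_join p n \<sqinter> partial_join q n = \<bottom>"
  proof (induction n)
    case (Suc n)
    then show ?case using disjoint_sums[OF *[of n]] assms(2) by simp
  qed simp
qed

lemma independent_even_odd:
  fixes f :: "nat \<Rightarrow> 'a::{bounded_lattice_bot, modular_lattice}"
  assumes "independent_seq f"
  shows "independent_seq (\<lambda>n. f (2 * n) \<squnion> f (2 * n + 1))" "f (2 * n) \<sqinter> f (2 * n + 1) = \<bottom>"
proof -
  have i: "partial_join f n \<sqinter> f n = \<bottom>" for n using assms by (simp add: independent_seq_def)
  have *: "(partial_join f n \<squnion> f n) \<sqinter> f (Suc n) = \<bottom>" for n using i[of "Suc n"] by simp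
  show "f (2 * n) \<sqinter> f (2 * n + 1) = \<bottom>" using *[of "2 * n"] by (auto intro: disjoint_mono)
  have "partial_join (\<lambda>n. f (2 * n) \<squnion> f (2 * n + 1)) n = partial_join f (2 * n)" for n
    by (induction n) (simp_all add: ac_simps)
  moreover have "partial_join f (2 * n) \<sqinter> (f (2 * n) \<squnion> f (2 * n + 1)) = \<bottom>" for n
    using disjoint_rotate[OF i *, of "2 * n"] by simp
  ultimately show "independent_seq (\<lambda>n. f (2 * n) \<squnion> f (2 * n + 1))"
    unfolding independent_seq_def by simp
qed

text \<open>
A sequence is independent as soon as its terms are split off successively from a descending chain.
\<close>
lemma independent_in_descending_chain:
  fixes u C :: "nat \<Rightarrow> 'a::{bounded_lattice_bot, modular_lattice}"
  assumes "\<And>n. u n \<sqinter> C (Suc n) = \<bottom>" "\<And>n. u n \<squnion> C (Suc n) \<le> C n"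
  shows "partial_join u n \<sqinter> C n = \<bottom>" "independent_seq u"
proof -
  show *: "partial_join u n \<sqinter> C n = \<bottom>" for n
  proof (induction n)
    case (Suc n)
    have "C (Suc n) \<sqinter> (u n \<squnion> partial_join u n) = \<bottom>"
    proof (rule disjoint_rotate)
      show "C (Suc n) \<sqinter> u n = \<bottom>" using assms(1)[of n] by (simp add: inf_commute)
      have "partial_join u n \<sqinter> (C (Suc n) \<squnion> u n) = \<bottom>"
        using Suc by (rule disjoint_mono) (use assms(2)[of n] in \<open>auto simp: sup_commute\<close>)
      then show "(C (Suc n) \<squnion> u n) \<sqinter> partial_join u n = \<bottom>" by (simp add: inf_commute)
    qed
    then show ?case by (simp add: ac_simps)
  qed simp
  show "independent_seq u"
    unfolding independent_seq_def
  proof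
    fix n
    show "partial_join u n \<sqinter> u n = \<bottom>"
      using *[of n] by (rule disjoint_mono) (use assms(2)[of n] in auto)
  qed
qed

lemma descending_remainders:
  fixes A m :: "nat \<Rightarrow> 'a::{bounded_lattice_bot, modular_lattice}"
  assumes "\<And>n. A n = A (Suc n) \<squnion> m n" "\<And>n. A (Suc n) \<sqinter> m n = \<bottom>"
  shows "independent_seq m" "partial_join m n \<sqinter> A n = \<bottom>" "partial_join m n \<squnion> A n = A 0"
proof -
  have *: "m n \<sqinter> A (Suc n) = \<bottom>" "m n \<squnion> A (Suc n) \<le> A n" for n
    using assms(2)[of n] by (simp add: inf_commute, subst (2) assms(1), simp)
  show "independent_seq m" "partial_join m n \<sqinter> A n = \<bottom>"
    using independent_in_descending_chain[of m A, OF *] by auto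
  show "partial_join m n \<squnion> A n = A 0"
  proof (induction n)
    case (Suc n)
    then show ?case using assms(1)[of n] by (simp add: ac_simps)
  qed simp
qed

context
  assumes cont: "conditionally_aleph0_meet_continuous
    TYPE('a::{sectionally_complemented_lattice, modular_lattice})"
begin

lemma seq_join_exists:
  fixes u :: "nat \<Rightarrow> 'a"
  assumes "\<And>n. u n \<le> d"
  obtains s where "s \<le> d" "seq_lub u s"
  using seq_lub_exists[OF cont, of "partial_join u" d] partial_join_le[of u d, OF assms]
  by (auto simp: seq_lub_partial_join)

lemma disjoint_seq_joins:
  fixes p q :: "nat \<Rightarrow> 'a"
  assumes "\<And>n. partial_join p n \<sqinter> partial_join q n = \<bottom>" "seq_lub p s" "seq_lub q t"
  shows "s \<sqinter> t = \<bottom>"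
  using disjoint_seq_lub[OF cont, of "partial_join p" "partial_join q"] assms
  by (simp add: seq_lub_partial_join)

lemma perspective_seq_joins:
  fixes u v :: "nat \<Rightarrow> 'a"
  assumes "independent_seq u" "independent_seq v" "\<And>n. perspective (u n) (v n)"
    "seq_lub u s" "seq_lub v t" "s \<sqinter> t = \<bottom>"
  shows "perspective s t"
proof (rule perspective_seq_lub[OF cont])
  show "perspective (partial_join u 0) (partial_join v 0)" by (simp add: perspective_refl)
  show "\<exists>x y. perspective x y \<and> partial_join u n \<sqinter> x = \<bottom> \<and> partial_join v n \<sqinter> y = \<bottom> \<and>
      partial_join u (Suc n) = partial_join u n \<squnion> x \<and> partial_join v (Suc n) = partial_join v n \<squnion> y" for n
    using assms(1-3) by (intro exI[of _ "u n"] exI[of _ "v n"]) (simp add: independent_seq_def)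
qed (use assms(4-6) in \<open>simp_all add: seq_lub_partial_join\<close>)

lemma seq_join_even_odd:
  fixes f :: "nat \<Rightarrow> 'a"
  assumes f: "independent_seq f" "seq_lub f F"
  obtains F0 F1 where "seq_lub (\<lambda>n. f (2 * n)) F0" "seq_lub (\<lambda>n. f (2 * n + 1)) F1"
    "F0 \<sqinter> F1 = \<bottom>" "F0 \<squnion> F1 = F"
proof -
  note le = seq_lub_upper[OF f(2)]
  obtain F0 where F0: "F0 \<le> F" "seq_lub (\<lambda>n. f (2 * n)) F0"
    using seq_join_exists[of "\<lambda>n. f (2 * n)" F] le by blast
  obtain F1 where F1: "F1 \<le> F" "seq_lub (\<lambda>n. f (2 * n + 1)) F1"
    using seq_join_exists[of "\<lambda>n. f (2 * n + 1)" F] le by blast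
  have "f n \<le> F0 \<squnion> F1" for n
  proof (cases "even n")
    case True
    then obtain k where "n = 2 * k" by blast
    then show ?thesis using seq_lub_upper[OF F0(2), of k] by (simp add: le_supI1)
  next
    case False
    then obtain k where "n = 2 * k + 1" by (rule oddE)
    then show ?thesis using seq_lub_upper[OF F1(2), of k] by (simp add: le_supI2)
  qed
  then have "F \<le> F0 \<squnion> F1" using seq_lub_least[OF f(2)] by blast
  then have "F0 \<squnion> F1 = F" using F0(1) F1(1) by (simp add: order_antisym)
  moreover have "F0 \<sqinter> F1 = \<bottom>"
    using disjoint_seq_joins[OF independent_pairs(3)[OF independent_even_odd[OF f(1)]] F0(2) F1(2)] .
  ultimately show ?thesis using that F0 F1 by blast
qed

section \<open>Uniqueness\<close>
context
  fixes R :: "'a \<Rightarrow> 'a \<Rightarrow> bool"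
  assumes normal: "normal_equivalence R"
begin

lemma normal_refl: "R x x"
  using normal by (simp add: normal_equivalence_def equivp_reflp)

lemma normal_sym: "R x y \<Longrightarrow> R y x"
  using normal unfolding normal_equivalence_def by (meson equivp_symp)

lemma normal_trans: "R x y \<Longrightarrow> R y z \<Longrightarrow> R x z"
  using normal unfolding normal_equivalence_def by (meson equivp_transp)

lemma perspective_imp_normal: "perspective x y \<Longrightarrow> R x y"
  using normal by (simp add: normal_equivalence_def)

lemma normal_disjoint_imp_perspective: "R x y \<Longrightarrow> x \<sqinter> y = \<bottom> \<Longrightarrow> perspective x y"
  using normal by (simp add: normal_equivalence_def perp_def)

lemma normal_sum:
  "R x x' \<Longrightarrow> R y y' \<Longrightarrow> x \<sqinter> y = \<bottom> \<Longrightarrow> x' \<sqinter> y' = \<bottom> \<Longrightarrow> R (x \<squnion> y) (x' \<squnion> y')"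
  using normal unfolding normal_equivalence_def additive_def is_oplus_def perp_def by blast

lemma normal_refine:
  assumes "R y (x0 \<squnion> x1)" "x0 \<sqinter> x1 = \<bottom>"
  obtains y0 y1 where "R y0 x0" "R y1 x1" "y0 \<sqinter> y1 = \<bottom>" "y = y0 \<squnion> y1"
proof -
  have "is_oplus (x0 \<squnion> x1) x0 x1" using assms(2) by (simp add: is_oplus_def perp_def)
  moreover have "refining R" using normal by (simp add: normal_equivalence_def)
  ultimately obtain y0 y1 where "R y0 x0" "R y1 x1" "is_oplus y y0 y1"
    using assms(1) unfolding refining_def by blast
  then show ?thesis using that by (auto simp: is_oplus_def perp_def)
qed

text \<open>
Transport the decomposition \<open>C \<oplus> X\<close> to \<open>s \<oplus> t = C \<oplus> Y\<close> and take the common refinement with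
\<open>C \<oplus> Y\<close>. The piece of \<open>X\<close> that falls into \<open>Y\<close> is matched (\<open>K\<close> with \<open>M\<close>); the rest \<open>X1\<close> of \<open>X\<close> has
a copy \<open>E\<close> inside \<open>C\<close>, and \<open>C' \<oplus> E \<equiv> C' \<oplus> Y1\<close> is a situation of the same kind.
\<close>
lemma exchange:
  assumes "C \<sqinter> X = \<bottom>" "C \<sqinter> Y = \<bottom>" "R (C \<squnion> X) (C \<squnion> Y)"
  obtains C' E X1 K Y1 M where
    "C = C' \<squnion> E" "C' \<sqinter> E = \<bottom>" "X = X1 \<squnion> K" "X1 \<sqinter> K = \<bottom>" "Y = Y1 \<squnion> M" "Y1 \<sqinter> M = \<bottom>"
    "R X1 E" "R K M" "R (C' \<squnion> E) (C' \<squnion> Y1)"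
proof -
  obtain s t where st: "R s C" "R t X" "s \<sqinter> t = \<bottom>" "C \<squnion> Y = s \<squnion> t"
    using normal_refine[OF normal_sym[OF assms(3)] assms(1)] by blast
  obtain E s' w where ref: "is_oplus C (C \<sqinter> s) E" "is_oplus s (C \<sqinter> s) s'"
    "perp s' w" "perp E w" "perspective Y (s' \<squnion> w)" "perspective t (E \<squnion> w)"
    using common_refinement[OF assms(2) st(3,4)] by blast
  have d: "C = (C \<sqinter> s) \<squnion> E" "(C \<sqinter> s) \<sqinter> E = \<bottom>" "s = (C \<sqinter> s) \<squnion> s'" "(C \<sqinter> s) \<sqinter> s' = \<bottom>"
    "s' \<sqinter> w = \<bottom>" "E \<sqinter> w = \<bottom>"
    using ref(1-4) by (auto simp: is_oplus_def perp_def)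
  obtain Y1 M where Y: "R Y1 s'" "R M w" "Y1 \<sqinter> M = \<bottom>" "Y = Y1 \<squnion> M"
    using normal_refine[OF perspective_imp_normal[OF ref(5)] d(5)] by blast
  have "R X (E \<squnion> w)" using normal_trans[OF normal_sym[OF st(2)] perspective_imp_normal[OF ref(6)]] .
  then obtain X1 K where X: "R X1 E" "R K w" "X1 \<sqinter> K = \<bottom>" "X = X1 \<squnion> K"
    using normal_refine[OF _ d(6)] by blast
  have "R K M" using normal_trans[OF X(2) normal_sym[OF Y(2)]] .
  moreover have "R C ((C \<sqinter> s) \<squnion> Y1)"
  proof -
    have "(C \<sqinter> s) \<sqinter> Y1 = \<bottom>" using assms(2) by (rule disjoint_mono) (use Y(4) in auto)
    then have "R ((C \<sqinter> s) \<squnion> s') ((C \<sqinter> s) \<squnion> Y1)"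
      using normal_sum[OF normal_refl normal_sym[OF Y(1)] d(4)] by blast
    then show ?thesis using normal_trans[OF normal_sym[OF st(1)]] d(3) by simp
  qed
  ultimately show ?thesis using that[of "C \<sqinter> s" E X1 K Y1 M] d(1,2) X Y by simp
qed

text \<open>
The elements \<open>A\<close> and \<open>B\<close> are represented by copies \<open>X\<close> and \<open>Y\<close> since, from the first step on, the
elements that are actually exchanged lie inside the original \<open>C\<close>, whereas \<open>A\<close> and \<open>B\<close> remain parts
of the two elements to be compared.
\<close>
definition exchangeable :: "'a \<Rightarrow> 'a \<Rightarrow> 'a \<Rightarrow> bool" where
  "exchangeable C A B \<longleftrightarrow>
     (\<exists>X Y. R A X \<and> R B Y \<and> C \<sqinter> X = \<bottom> \<and> C \<sqinter> Y = \<bottom> \<and> R (C \<squnion> X) (C \<squnion> Y))"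

text \<open>
Exchanging once from each side keeps the situation symmetric: what remains of \<open>A\<close> and what remains
of \<open>B\<close> both acquire a copy (\<open>E\<close> and \<open>F\<close>) in \<open>C\<close>, disjoint from the new \<open>C'\<close>, while the parts \<open>m\<close>
and \<open>k\<close> are matched.
\<close>
lemma exchangeable_step:
  assumes "exchangeable C A B"
  shows "\<exists>C' A' B'. exchangeable C' A' B' \<and>
    (\<exists>m k. A = A' \<squnion> m \<and> A' \<sqinter> m = \<bottom> \<and> B = B' \<squnion> k \<and> B' \<sqinter> k = \<bottom> \<and> R m k) \<and>
    (\<exists>E F. R E A' \<and> R F B' \<and> E \<sqinter> F = \<bottom> \<and> (E \<squnion> F) \<sqinter> C' = \<bottom> \<and> E \<squnion> F \<squnion> C' \<le> C)"
proof -
  obtain X Y where XY: "R A X" "R B Y" "C \<sqinter> X = \<bottom>" "C \<sqinter> Y = \<bottom>" "R (C \<squnion> X) (C \<squnion> Y)"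
    using assms unfolding exchangeable_def by blast
  obtain C1 E X1 K Y1 M where 1:
    "C = C1 \<squnion> E" "C1 \<sqinter> E = \<bottom>" "X = X1 \<squnion> K" "X1 \<sqinter> K = \<bottom>" "Y = Y1 \<squnion> M" "Y1 \<sqinter> M = \<bottom>"
    "R X1 E" "R K M" "R (C1 \<squnion> E) (C1 \<squnion> Y1)"
    using exchange[OF XY(3-5)] by metis
  have "C1 \<sqinter> Y1 = \<bottom>" using XY(4) by (rule disjoint_mono) (use 1 in auto)
  then obtain C2 F Y2 N E1 L where 2:
    "C1 = C2 \<squnion> F" "C2 \<sqinter> F = \<bottom>" "Y1 = Y2 \<squnion> N" "Y2 \<sqinter> N = \<bottom>" "E = E1 \<squnion> L" "E1 \<sqinter> L = \<bottom>"
    "R Y2 F" "R N L" "R (C2 \<squnion> F) (C2 \<squnion> E1)"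
    using exchange[OF _ 1(2) normal_sym[OF 1(9)]] by metis
  have "R X1 (E1 \<squnion> L)" using 1(7) 2(5) by simp
  then obtain X2 P where X1: "R X2 E1" "R P L" "X2 \<sqinter> P = \<bottom>" "X1 = X2 \<squnion> P"
    using normal_refine[OF _ 2(6)] by blast
  have X: "X = X2 \<squnion> (P \<squnion> K)" "X2 \<sqinter> (P \<squnion> K) = \<bottom>" "P \<sqinter> K = \<bottom>"
    using 1(3,4) X1(3,4) disjoint_rotate[of X2 P K] by (auto simp: sup_assoc intro: disjoint_mono)
  have Y: "Y = Y2 \<squnion> (N \<squnion> M)" "Y2 \<sqinter> (N \<squnion> M) = \<bottom>" "N \<sqinter> M = \<bottom>"
    using 1(5,6) 2(3,4) disjoint_rotate[of Y2 N M] by (auto simp: sup_assoc intro: disjoint_mono)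
  have PKNM: "R (P \<squnion> K) (N \<squnion> M)"
    using normal_sum[OF normal_trans[OF X1(2) normal_sym[OF 2(8)]] 1(8) X(3) Y(3)] .
  obtain A' m where A: "R A' X2" "R m (P \<squnion> K)" "A' \<sqinter> m = \<bottom>" "A = A' \<squnion> m"
    using normal_refine[OF _ X(2)] XY(1) X(1) by metis
  obtain B' k where B: "R B' Y2" "R k (N \<squnion> M)" "B' \<sqinter> k = \<bottom>" "B = B' \<squnion> k"
    using normal_refine[OF _ Y(2)] XY(2) Y(1) by metis
  have E1: "R A' E1" using normal_trans[OF A(1) X1(1)] .
  have F: "R B' F" using normal_trans[OF B(1) 2(7)] .
  have "(F \<squnion> C2) \<sqinter> E1 = \<bottom>" using 1(2) by (rule disjoint_mono) (use 2(1,5) in \<open>auto simp: sup_commute\<close>)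
  then have "C2 \<sqinter> (F \<squnion> E1) = \<bottom>" and "E1 \<sqinter> F = \<bottom>" and "C2 \<sqinter> E1 = \<bottom>"
    using disjoint_rotate[OF 2(2)] disjoint_mono[of "F \<squnion> C2" E1 F E1] disjoint_mono[of "F \<squnion> C2" E1 C2 E1]
    by (simp_all add: sup_commute inf_commute)
  then have "(E1 \<squnion> F) \<sqinter> C2 = \<bottom>" by (simp add: ac_simps)
  moreover have "exchangeable C2 A' B'"
    unfolding exchangeable_def using E1 F \<open>C2 \<sqinter> E1 = \<bottom>\<close> 2(2) normal_sym[OF 2(9)] by blast
  moreover have "E1 \<squnion> F \<squnion> C2 \<le> C" using 1(1) 2(1,5) by (simp add: le_supI1 le_supI2)
  moreover have "R m k" using normal_trans[OF normal_trans[OF A(2) PKNM] normal_sym[OF B(2)]] .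
  ultimately show ?thesis using A(3,4) B(3,4) normal_sym[OF E1] normal_sym[OF F] \<open>E1 \<sqinter> F = \<bottom>\<close> by blast
qed

lemma exchange_sequence:
  assumes "exchangeable c a b"
  obtains C A B m k E F where
    "A 0 = a" "\<And>n. A n = A (Suc n) \<squnion> m n" "\<And>n. A (Suc n) \<sqinter> m n = \<bottom>"
    "B 0 = b" "\<And>n. B n = B (Suc n) \<squnion> k n" "\<And>n. B (Suc n) \<sqinter> k n = \<bottom>"
    "\<And>n::nat. R (m n) (k n)" "\<And>n. R (E n) (A (Suc n))" "\<And>n. R (F n) (B (Suc n))"
    "\<And>n. E n \<sqinter> F n = \<bottom>"
    "C 0 = c" "\<And>n. (E n \<squnion> F n) \<sqinter> C (Suc n) = \<bottom>" "\<And>n. E n \<squnion> F n \<squnion> C (Suc n) \<le> C n"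
proof -
  define inv where "inv n = (\<lambda>(C, A, B). exchangeable C A B \<and> (n = 0 \<longrightarrow> (C, A, B) = (c, a, b)))" for n :: nat
  define step where "step = (\<lambda>(C, A, B) (C', A', B').
    (\<exists>m k. A = A' \<squnion> m \<and> A' \<sqinter> m = \<bottom> \<and> B = B' \<squnion> k \<and> B' \<sqinter> k = \<bottom> \<and> R m k) \<and>
    (\<exists>E F. R E A' \<and> R F B' \<and> E \<sqinter> F = \<bottom> \<and> (E \<squnion> F) \<sqinter> C' = \<bottom> \<and> E \<squnion> F \<squnion> C' \<le> C))"
  have "\<exists>x. inv 0 x" using assms by (auto simp: inv_def)
  moreover have "\<exists>y. inv (Suc n) y \<and> step x y" if "inv n x" for n x
    using that exchangeable_step unfolding inv_def step_def by (cases x) fastforce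
  ultimately obtain S where S: "\<And>n. inv n (S n)" "\<And>n. step (S n) (S (Suc n))"
    using dependent_nat_choice[of inv "\<lambda>_. step"] by blast
  define C where "C n = fst (S n)" for n
  define A where "A n = fst (snd (S n))" for n
  define B where "B n = snd (snd (S n))" for n
  have S_eq: "S n = (C n, A n, B n)" for n by (simp add: C_def A_def B_def)
  have "\<forall>n. \<exists>m k. A n = A (Suc n) \<squnion> m \<and> A (Suc n) \<sqinter> m = \<bottom> \<and>
      B n = B (Suc n) \<squnion> k \<and> B (Suc n) \<sqinter> k = \<bottom> \<and> R m k"
    using S(2) unfolding step_def S_eq by auto
  then obtain m k where mk: "\<And>n. A n = A (Suc n) \<squnion> m n \<and> A (Suc n) \<sqinter> m n = \<bottom> \<and>
      B n = B (Suc n) \<squnion> k n \<and> B (Suc n) \<sqinter> k n = \<bottom> \<and> R (m n) (k n)"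
    by metis
  have "\<forall>n. \<exists>E F. R E (A (Suc n)) \<and> R F (B (Suc n)) \<and> E \<sqinter> F = \<bottom> \<and>
      (E \<squnion> F) \<sqinter> C (Suc n) = \<bottom> \<and> E \<squnion> F \<squnion> C (Suc n) \<le> C n"
    using S(2) unfolding step_def S_eq by auto
  then obtain E F where EF: "\<And>n. R (E n) (A (Suc n)) \<and> R (F n) (B (Suc n)) \<and> E n \<sqinter> F n = \<bottom> \<and>
      (E n \<squnion> F n) \<sqinter> C (Suc n) = \<bottom> \<and> E n \<squnion> F n \<squnion> C (Suc n) \<le> C n"
    by metis
  have "C 0 = c" "A 0 = a" "B 0 = b" using S(1)[of 0] by (auto simp: inv_def S_eq)
  then show ?thesis using that[of A m B k E F C] mk EF by blast
qed

text \<open>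
The meet of a descending sequence of remainders need not exist. Instead \<open>r\<close> is a complement of the
join of the removed parts, and it embeds into each remainder \<open>A\<close> up to perspectivity: both \<open>A\<close> and an
element containing \<open>r\<close> are complements of the parts removed so far.
\<close>
lemma copy_of_limit_remainder:
  assumes "seq_lub m d" "d \<sqinter> r = \<bottom>" "d \<squnion> r = a"
    and "partial_join m n \<sqinter> A = \<bottom>" "partial_join m n \<squnion> A = a" "R E A"
  shows "\<exists>f\<le>E. R f r"
proof -
  let ?D = "partial_join m n"
  have "?D \<le> d" using seq_lub_upper[OF assms(1)] by (rule partial_join_le)
  then obtain l where l: "?D \<sqinter> l = \<bottom>" "?D \<squnion> l = d" using section_complement by blast
  have lr: "?D \<sqinter> (l \<squnion> r) = \<bottom>" using disjoint_rotate[OF l(1)] l(2) assms(2) by simp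
  have "perspective A (l \<squnion> r)"
    using complements_perspective[OF assms(4) lr] l(2) assms(3,5) by (simp add: sup_assoc[symmetric])
  then have "R E (l \<squnion> r)" using normal_trans[OF assms(6) perspective_imp_normal] by blast
  moreover have "l \<sqinter> r = \<bottom>" using assms(2) by (rule disjoint_mono) (use l(2) in auto)
  ultimately obtain y0 y1 where "R y1 r" "E = y0 \<squnion> y1" using normal_refine by blast
  then show ?thesis by (intro exI[of _ y1]) simp
qed

text \<open>
The halves are the joins of the terms with even and with odd index. Matching \<open>e\<close> with the first even
term, and each odd term with the next even term, shows that the odd half absorbs \<open>e\<close>, as in Hilbert's
hotel. Splitting into halves is what makes the two sides disjoint, so that related terms are perspective
and countable additivity applies.
\<close>
lemma absorption:
  assumes f: "independent_seq f" "seq_lub f F" "\<And>n. R (f n) e" and e: "F \<sqinter> e = \<bottom>"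
  obtains F0 F1 where "F0 \<sqinter> F1 = \<bottom>" "F0 \<squnion> F1 = F" "perspective F0 F1" "perspective (F1 \<squnion> e) F0"
proof -
  obtain F0 F1 where F: "seq_lub (\<lambda>n. f (2 * n)) F0" "seq_lub (\<lambda>n. f (2 * n + 1)) F1"
    "F0 \<sqinter> F1 = \<bottom>" "F0 \<squnion> F1 = F"
    using seq_join_even_odd[OF f(1,2)] .
  define p where "p n = f (2 * n)" for n
  define q where "q n = f (2 * n + 1)" for n
  have F0: "seq_lub p F0" and F1: "seq_lub q F1" using F(1,2) unfolding p_def q_def .
  note pq = independent_pairs(1,2)[OF independent_even_odd[OF f(1)], folded p_def q_def]
  have Rpq: "R (p n) e" "R (q n) e" for n using f(3) by (simp_all add: p_def q_def)
  have persp: "perspective x (p n)" if "R x e" "x \<sqinter> F0 = \<bottom>" for x n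
  proof (rule normal_disjoint_imp_perspective)
    show "R x (p n)" using normal_trans[OF that(1) normal_sym[OF Rpq(1)]] .
    show "x \<sqinter> p n = \<bottom>" using that(2) by (rule disjoint_mono) (use seq_lub_upper[OF F0] in auto)
  qed
  have "F0 \<sqinter> (F1 \<squnion> e) = \<bottom>" using disjoint_rotate[OF F(3)] F(4) e by simp
  then have F1e: "(F1 \<squnion> e) \<sqinter> F0 = \<bottom>" by (simp add: inf_commute)
  have q_le: "q n \<le> F1" for n using seq_lub_upper[OF F1] .
  have "perspective (q n) (p n)" for n
    using persp[OF Rpq(2)] disjoint_mono[OF F1e _ order_refl] q_le by (simp add: le_supI1)
  then have "perspective F1 F0"
    using perspective_seq_joins[OF pq(2,1) _ F1 F0] F(3) by (simp add: inf_commute)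
  moreover have "perspective (F1 \<squnion> e) F0"
  proof -
    define u where "u = case_nat e q"
    have u_simps: "u 0 = e" "u (Suc n) = q n" for n by (simp_all add: u_def)
    have pj: "partial_join u (Suc n) = e \<squnion> partial_join q n" for n
      by (induction n) (simp_all add: u_simps ac_simps)
    have "independent_seq u"
      unfolding independent_seq_def
    proof
      fix n
      show "partial_join u n \<sqinter> u n = \<bottom>"
      proof (cases n)
        case (Suc i)
        have "q i \<sqinter> (partial_join q i \<squnion> e) = \<bottom>"
        proof (rule disjoint_rotate)
          show "q i \<sqinter> partial_join q i = \<bottom>"
            using pq(2) by (simp add: independent_seq_def inf_commute)
          have "partial_join q i \<le> F1" using q_le by (rule partial_join_le)
          then show "(q i \<squnion> partial_join q i) \<sqinter> e = \<bottom>"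
            using disjoint_mono[OF e] q_le[of i] F(4) by (metis le_supI le_supI2 order_refl)
        qed
        then show ?thesis using Suc pj by (simp add: u_simps ac_simps)
      qed simp
    qed
    moreover have "seq_lub u (F1 \<squnion> e)"
      unfolding seq_lub_def
    proof (intro conjI allI impI)
      show "u n \<le> F1 \<squnion> e" for n using q_le by (cases n) (simp_all add: u_simps le_supI1)
      show "F1 \<squnion> e \<le> b" if "\<forall>n. u n \<le> b" for b
        using that seq_lub_least[OF F1, of b] u_simps by (metis le_sup_iff)
    qed
    moreover have "perspective (u n) (p n)" for n
    proof (rule persp)
      show "R (u n) e" using Rpq(2) normal_refl by (cases n) (simp_all add: u_simps)
      show "u n \<sqinter> F0 = \<bottom>"
        using F1e by (rule disjoint_mono) (use q_le in \<open>cases n; simp add: u_simps le_supI1\<close>)+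
    qed
    ultimately show ?thesis using perspective_seq_joins[OF _ pq(1) _ _ F0 F1e] by blast
  qed
  ultimately show ?thesis using that F(3,4) perspective_sym by blast
qed

text \<open>
The common part \<open>c\<close> cannot be matched with itself, since it has to absorb \<open>x'\<close> on one side and \<open>y'\<close>
on the other. Exchanging the halves of \<open>P\<close> and \<open>Q\<close> makes each piece perspective to its partner.
\<close>
lemma normal_imp_two_pieces:
  assumes "R a b"
  shows "\<exists>a0 a1 b0 b1. is_oplus a a0 a1 \<and> is_oplus b b0 b1 \<and> perspective a0 b0 \<and> perspective a1 b1"
proof -
  define c where "c = a \<sqinter> b"
  obtain x where x: "c \<sqinter> x = \<bottom>" "c \<squnion> x = a" using section_complement[of c a] by (auto simp: c_def)
  obtain y where y: "c \<sqinter> y = \<bottom>" "c \<squnion> y = b" using section_complement[of c b] by (auto simp: c_def)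
  have "(c \<squnion> x) \<sqinter> y \<le> c \<sqinter> y" using x(2) y(2) unfolding c_def
    by (metis inf.bounded_iff inf_le1 inf_le2 order_trans sup_ge2)
  then have "(c \<squnion> x) \<sqinter> y = \<bottom>" using y(1) by (simp add: bot_unique)
  then have cxy: "c \<sqinter> (x \<squnion> y) = \<bottom>" and xy: "x \<sqinter> y = \<bottom>"
    using disjoint_rotate[OF x(1)] by (auto intro: disjoint_mono)
  have "exchangeable c x y"
    unfolding exchangeable_def using normal_refl x y assms by metis
  then obtain C A B m k E F where seq:
    "A 0 = x" "\<And>n. A n = A (Suc n) \<squnion> m n" "\<And>n. A (Suc n) \<sqinter> m n = \<bottom>"
    "B 0 = y" "\<And>n. B n = B (Suc n) \<squnion> k n" "\<And>n. B (Suc n) \<sqinter> k n = \<bottom>"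
    "\<And>n::nat. R (m n) (k n)" "\<And>n. R (E n) (A (Suc n))" "\<And>n. R (F n) (B (Suc n))"
    "\<And>n. E n \<sqinter> F n = \<bottom>"
    "C 0 = c" "\<And>n. (E n \<squnion> F n) \<sqinter> C (Suc n) = \<bottom>" "\<And>n. E n \<squnion> F n \<squnion> C (Suc n) \<le> C n"
    using exchange_sequence by metis
  note A = descending_remainders[of A m, OF seq(2,3)]
  note B = descending_remainders[of B k, OF seq(5,6)]
  have m_le: "m n \<le> x" for n using A(3)[of "Suc n"] seq(1) by (metis le_sup_iff order_refl partial_join.simps(2))
  have k_le: "k n \<le> y" for n using B(3)[of "Suc n"] seq(4) by (metis le_sup_iff order_refl partial_join.simps(2))
  obtain d where d: "d \<le> x" "seq_lub m d" using seq_join_exists[of m x] m_le by blast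
  obtain d' where d': "d' \<le> y" "seq_lub k d'" using seq_join_exists[of k y] k_le by blast
  obtain x' where x': "d \<sqinter> x' = \<bottom>" "d \<squnion> x' = x" using section_complement[OF d(1)] by blast
  obtain y' where y': "d' \<sqinter> y' = \<bottom>" "d' \<squnion> y' = y" using section_complement[OF d'(1)] by blast
  have dd': "perspective d d'"
  proof (rule perspective_seq_joins[OF A(1) B(1) _ d(2) d'(2)])
    show "perspective (m n) (k n)" for n
      using normal_disjoint_imp_perspective[OF seq(7)] disjoint_mono[OF xy m_le k_le] by blast
    show "d \<sqinter> d' = \<bottom>" using disjoint_mono[OF xy d(1) d'(1)] .
  qed
  have "\<forall>n. \<exists>f\<le>E n. R f x'"
    using copy_of_limit_remainder[OF d(2) x'] A(2,3) seq(1,8) by metis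
  then obtain f where f: "\<And>n. f n \<le> E n" "\<And>n. R (f n) x'" by metis
  have "\<forall>n. \<exists>g\<le>F n. R g y'"
    using copy_of_limit_remainder[OF d'(2) y'] B(2,3) seq(4,9) by metis
  then obtain g where g: "\<And>n. g n \<le> F n" "\<And>n. R (g n) y'" by metis
  have fg_le: "f n \<squnion> g n \<le> E n \<squnion> F n" for n using f(1) g(1) by (meson sup_mono)
  have "independent_seq (\<lambda>n. f n \<squnion> g n)"
  proof (rule independent_in_descending_chain(2))
    show "(f n \<squnion> g n) \<sqinter> C (Suc n) = \<bottom>" for n
      using disjoint_mono[OF seq(12) fg_le order_refl] .
    show "f n \<squnion> g n \<squnion> C (Suc n) \<le> C n" for n
      using seq(13)[of n] fg_le[of n] by (meson le_sup_iff order_trans)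
  qed
  moreover have "f n \<sqinter> g n = \<bottom>" for n using disjoint_mono[OF seq(10) f(1) g(1)] .
  ultimately have fg: "independent_seq f" "independent_seq g"
    "\<And>n. partial_join f n \<sqinter> partial_join g n = \<bottom>"
    using independent_pairs by blast+
  have "C n \<le> c" for n
    using seq(13) by (induction n) (auto simp: seq(11) intro: order_trans)
  then have "E n \<squnion> F n \<le> c" for n using seq(13) by (meson le_sup_iff order_trans)
  then have fg_c: "f n \<le> c" "g n \<le> c" for n using f(1) g(1) by (meson le_sup_iff order_trans)+
  obtain P where P: "P \<le> c" "seq_lub f P" using seq_join_exists[of f c] fg_c by blast
  obtain Q where Q: "Q \<le> c" "seq_lub g Q" using seq_join_exists[of g c] fg_c by blast
  have PQ: "P \<sqinter> Q = \<bottom>" using disjoint_seq_joins[OF fg(3) P(2) Q(2)] .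
  have "P \<sqinter> x' = \<bottom>" using cxy by (rule disjoint_mono) (use P(1) x'(2) in \<open>auto intro: le_supI1\<close>)
  then obtain P0 P1 where P01: "P0 \<sqinter> P1 = \<bottom>" "P0 \<squnion> P1 = P" "perspective P0 P1" "perspective (P1 \<squnion> x') P0"
    using absorption[OF fg(1) P(2) f(2)] by blast
  have "Q \<sqinter> y' = \<bottom>" using cxy by (rule disjoint_mono) (use Q(1) y'(2) in \<open>auto intro: le_supI2\<close>)
  then obtain Q0 Q1 where Q01: "Q0 \<sqinter> Q1 = \<bottom>" "Q0 \<squnion> Q1 = Q" "perspective Q0 Q1" "perspective (Q1 \<squnion> y') Q0"
    using absorption[OF fg(2) Q(2) g(2)] by blast
  have "P \<squnion> Q \<le> c" using P(1) Q(1) by simp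
  then obtain r where r: "(P \<squnion> Q) \<sqinter> r = \<bottom>" "(P \<squnion> Q) \<squnion> r = c" using section_complement by blast
  let ?S = "P0 \<squnion> Q1" and ?T = "P1 \<squnion> Q0"
  have ST: "?S \<squnion> ?T = P \<squnion> Q" using P01(2) Q01(2) by (auto simp: ac_simps)
  have S_T: "?S \<sqinter> ?T = \<bottom>"
    using disjoint_sums[OF PQ, of P0 P1 Q1 Q0] P01(1,2) Q01(1,2) by (auto simp: inf_commute)
  have rST: "(r \<squnion> ?S) \<sqinter> ?T = \<bottom>" "(r \<squnion> ?T) \<sqinter> ?S = \<bottom>"
    using disjoint_rotate[of ?T ?S r] disjoint_rotate[of ?S ?T r] S_T r(1) ST
    by (simp_all add: sup_commute inf_commute)
  have le: "r \<squnion> ?S \<le> c" "r \<squnion> ?T \<le> c" "?S \<le> c" "?T \<le> c" "d \<le> x" "x' \<le> x" "d' \<le> y" "y' \<le> y"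
  proof -
    have "r \<squnion> (?S \<squnion> ?T) \<le> c" using r(2) ST by (simp add: sup_commute)
    then show "r \<squnion> ?S \<le> c" "r \<squnion> ?T \<le> c" "?S \<le> c" "?T \<le> c" by simp_all
    show "d \<le> x" "x' \<le> x" "d' \<le> y" "y' \<le> y" using x'(2) y'(2) by auto
  qed
  have "is_oplus a ((r \<squnion> ?S) \<squnion> d) (?T \<squnion> x')"
  proof -
    have "((r \<squnion> ?S) \<squnion> d) \<sqinter> (?T \<squnion> x') = \<bottom>"
      using disjoint_sums[OF x(1) le(1,4,5,6) rST(1) x'(1)] .
    moreover have "((r \<squnion> ?S) \<squnion> d) \<squnion> (?T \<squnion> x') = ((?S \<squnion> ?T) \<squnion> r) \<squnion> (d \<squnion> x')" by (simp add: ac_simps)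
    then have "a = ((r \<squnion> ?S) \<squnion> d) \<squnion> (?T \<squnion> x')" using ST r(2) x'(2) x(2) by simp
    ultimately show ?thesis by (simp add: is_oplus_def perp_def)
  qed
  moreover have "is_oplus b ((r \<squnion> ?T) \<squnion> d') (?S \<squnion> y')"
  proof -
    have "((r \<squnion> ?T) \<squnion> d') \<sqinter> (?S \<squnion> y') = \<bottom>"
      using disjoint_sums[OF y(1) le(2,3,7,8) rST(2) y'(1)] .
    moreover have "((r \<squnion> ?T) \<squnion> d') \<squnion> (?S \<squnion> y') = ((?S \<squnion> ?T) \<squnion> r) \<squnion> (d' \<squnion> y')" by (simp add: ac_simps)
    then have "b = ((r \<squnion> ?T) \<squnion> d') \<squnion> (?S \<squnion> y')" using ST r(2) y'(2) y(2) by simp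
    ultimately show ?thesis by (simp add: is_oplus_def perp_def)
  qed
  moreover have "perspective ((r \<squnion> ?S) \<squnion> d) ((r \<squnion> ?T) \<squnion> d')"
  proof (rule perspective_sum[OF _ dd'])
    show "perspective (r \<squnion> ?S) (r \<squnion> ?T)"
    proof (rule perspective_sum[OF perspective_refl])
      show "perspective ?S ?T"
        using perspective_sum[OF P01(3) perspective_sym[OF Q01(3)]] P01(2) Q01(2) PQ by (simp add: sup_commute)
      show "(r \<squnion> r) \<sqinter> (?S \<squnion> ?T) = \<bottom>" using r(1) ST by (simp add: inf_commute)
    qed
    show "((r \<squnion> ?S) \<squnion> (r \<squnion> ?T)) \<sqinter> (d \<squnion> d') = \<bottom>"
      using cxy by (rule disjoint_mono) (use le in \<open>simp_all add: le_supI1 le_supI2\<close>)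
  qed
  moreover have "perspective (?T \<squnion> x') (?S \<squnion> y')"
  proof -
    have "(P \<squnion> x') \<sqinter> (Q \<squnion> y') = \<bottom>"
    proof (rule disjoint_sums[OF cxy P(1) Q(1) _ _ PQ])
      show "x' \<sqinter> y' = \<bottom>" using disjoint_mono[OF xy le(6,8)] .
    qed (use le in \<open>simp_all add: le_supI1 le_supI2\<close>)
    moreover have "(P1 \<squnion> x') \<squnion> P0 = P \<squnion> x'" "Q0 \<squnion> (Q1 \<squnion> y') = Q \<squnion> y'"
      using P01(2) Q01(2) by (auto simp: ac_simps)
    ultimately have "perspective ((P1 \<squnion> x') \<squnion> Q0) (P0 \<squnion> (Q1 \<squnion> y'))"
      using perspective_sum[OF P01(4) perspective_sym[OF Q01(4)]] by simp
    then show ?thesis by (simp add: ac_simps)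
  qed
  ultimately show ?thesis by blast
qed

lemma normal_iff_two_pieces:
  "R a b \<longleftrightarrow> (\<exists>a0 a1 b0 b1. is_oplus a a0 a1 \<and> is_oplus b b0 b1 \<and>
                   perspective a0 b0 \<and> perspective a1 b1)"
  using normal_imp_two_pieces normal_sum perspective_imp_normal unfolding is_oplus_def perp_def by blast

end

end

theorem theorem13p2:
  assumes "conditionally_aleph0_meet_continuous
             TYPE('a::{sectionally_complemented_lattice, modular_lattice})"
  shows "(\<exists>!R :: 'a \<Rightarrow> 'a \<Rightarrow> bool. normal_equivalence R) \<and>
         (\<forall>R :: 'a \<Rightarrow> 'a \<Rightarrow> bool. normal_equivalence R \<longrightarrow>
            (\<forall>a b. R a b \<longleftrightarrow>
               (\<exists>a0 a1 b0 b1. is_oplus a a0 a1 \<and> is_oplus b b0 b1 \<and>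
                              perspective a0 b0 \<and> perspective a1 b1)))"
proof -
  note two_pieces = normal_iff_two_pieces[OF assms]
  have "\<exists>!R :: 'a \<Rightarrow> 'a \<Rightarrow> bool. normal_equivalence R"
  proof (rule ex1I)
    show "normal_equivalence (piecewise_projective :: 'a \<Rightarrow> 'a \<Rightarrow> bool)"
      using assms by (rule normal_equivalence_piecewise_projective)
    fix R :: "'a \<Rightarrow> 'a \<Rightarrow> bool"
    assume "normal_equivalence R"
    note both = two_pieces[OF this]
      two_pieces[OF normal_equivalence_piecewise_projective[OF assms]]
    show "R = piecewise_projective"
      by (intro ext) (rule trans[OF both(1) both(2)[symmetric]])
  qed
  then show ?thesis using two_pieces by blast
qed

end
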